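(* For any $f\in\mathcal{F}(\mathbb{R}^n)$ such that $\int e^{-f^*}\,dx>0$, it holds \[ \sup_{\nu\in\mathcal{P}_1(\mathbb{R}^n)}\left\{\int(-f)\,d\nu-K(\nu|\mathrm{Leb})\right\}=L(f|\mathrm{Leb}), \] and the supremum can be restricted to compactly supported $\nu$. If $f$ is further assumed to be unconditional (resp. symmetric), then the supremum above can be restricted to $\mathcal{P}_{u,1}(\mathbb{R}^n)$ (resp. $\mathcal{P}_{s,1}(\mathbb{R}^n)$).
   Context: $\mathcal{F}(\mathbb{R}^n)$ is the set of lower semicontinuous convex functions $f:\mathbb{R}^n\to\mathbb{R}\cup\{+\infty\}$ finite at at least one point, and $f^*(y)=\sup_{x\in\mathbb{R}^n}\{x\cdot y-f(x)\}$. $\mathcal{P}_1(\mathbb{R}^n)$ is the set of Borel probability measures with finite first moment; for $f\in\mathcal{F}(\mathbb{R}^n)$ and $\nu\in\mathcal{P}_1(\mathbb{R}^n)$, $\int f\,d\nu$ is well defined in $\mathbb{R}\cup\{+\infty\}$. Functions/measures are symmetric if invariant under $x\mapsto-x$, unconditional if invariant under all maps $x\mapsto(\varepsilon_1x_1,\ldots,\varepsilon_nx_n)$, $\varepsilon\in\{-1,1\}^n$; $\mathcal{P}_{s,1}(\mathbb{R}^n)$ and $\mathcal{P}_{u,1}(\mathbb{R}^n)$ are the symmetric, resp. unconditional, elements of $\mathcal{P}_1(\mathbb{R}^n)$. With Leb the Lebesgue measure on $\mathbb{R}^n$, define $L(f|\mathrm{Leb})=-\log\int e^{-f^*}\,dx$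 for $f\in\mathcal{F}(\mathbb{R}^n)$ (with $\log0=-\infty$, $\log(+\infty)=+\infty$), and for $\nu\in\mathcal{P}_1(\mathbb{R}^n)$, \[ K(\nu|\mathrm{Leb})=\sup_{g\in L^1(\nu)\cap\mathcal{F}(\mathbb{R}^n)}\left\{\int(-g)\,d\nu-L(g|\mathrm{Leb})\right\}. \] *)

theory Defs
  imports "HOL-Probability.Probability"
begin

text \<open>Functions into \<open>\<real> \<union> {+\<infinity>}\<close> are rendered as \<^typ>\<open>ereal\<close>-valued functions that
  never take the value \<open>-\<infinity>\<close>. In the convexity inequality the coefficients may vanish; this is
  harmless since \<open>0 * \<infinity> = 0\<close> in \<^typ>\<open>ereal\<close>.\<close>

definition lower_semicontinuous :: "('a::topological_space \<Rightarrow> ereal) \<Rightarrow> bool" where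
  "lower_semicontinuous f \<longleftrightarrow> (\<forall>x. f x \<le> Liminf (at x) f)"

definition ereal_convex :: "('a::real_vector \<Rightarrow> ereal) \<Rightarrow> bool" where
  "ereal_convex f \<longleftrightarrow> (\<forall>x y. \<forall>u\<ge>0. \<forall>v\<ge>0. u + v = 1 \<longrightarrow>
     f (u *\<^sub>R x + v *\<^sub>R y) \<le> ereal u * f x + ereal v * f y)"

definition convex_lsc_funs :: "(real ^ 'n \<Rightarrow> ereal) set" where
  "convex_lsc_funs = {f. (\<forall>x. f x \<noteq> -\<infinity>) \<and> (\<exists>x. f x \<noteq> \<infinity>) \<and>
     lower_semicontinuous f \<and> ereal_convex f}"

definition conjugate :: "(real ^ 'n \<Rightarrow> ereal) \<Rightarrow> real ^ 'n \<Rightarrow> ereal" where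
  "conjugate f y = (SUP x. ereal (x \<bullet> y) - f x)"

definition exp_ereal :: "ereal \<Rightarrow> ennreal" where
  "exp_ereal a = (case a of ereal r \<Rightarrow> ennreal (exp r) | PInfty \<Rightarrow> \<top> | MInfty \<Rightarrow> 0)"

definition ln_ennreal :: "ennreal \<Rightarrow> ereal" where
  "ln_ennreal a = (if a = 0 then -\<infinity> else if a = \<top> then \<infinity> else ereal (ln (enn2real a)))"

definition exp_conj_integral :: "(real ^ 'n \<Rightarrow> ereal) \<Rightarrow> ennreal" where
  "exp_conj_integral f = (\<integral>\<^sup>+ y. exp_ereal (- conjugate f y) \<partial>lborel)"

definition L_Leb :: "(real ^ 'n \<Rightarrow> ereal) \<Rightarrow> ereal" where
  "L_Leb f = - ln_ennreal (exp_conj_integral f)"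

text \<open>Since \<^const>\<open>e2ennreal\<close> sends negative values to \<open>0\<close>, the two terms below are the
  integrals of the positive and the negative part. The value is meaningful when at least one
  of them is finite.\<close>

definition ereal_integral :: "'a measure \<Rightarrow> ('a \<Rightarrow> ereal) \<Rightarrow> ereal" where
  "ereal_integral M f =
     enn2ereal (\<integral>\<^sup>+ x. e2ennreal (f x) \<partial>M) - enn2ereal (\<integral>\<^sup>+ x. e2ennreal (- f x) \<partial>M)"

definition ereal_L1 :: "'a measure \<Rightarrow> ('a \<Rightarrow> ereal) set" where
  "ereal_L1 M = {g. g \<in> borel_measurable M \<and> (\<integral>\<^sup>+ x. e2ennreal \<bar>g x\<bar> \<partial>M) < \<infinity>}"

definition P1 :: "(real ^ 'n) measure set" where
  "P1 = {\<nu>. prob_space \<nu> \<and> sets \<nu> = sets borel \<and> integrable \<nu> norm}"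

definition K_Leb :: "(real ^ 'n) measure \<Rightarrow> ereal" where
  "K_Leb \<nu> = (SUP g \<in> ereal_L1 \<nu> \<inter> convex_lsc_funs. ereal_integral \<nu> (\<lambda>x. - g x) - L_Leb g)"

definition measure_support :: "'a::topological_space measure \<Rightarrow> 'a set" where
  "measure_support \<nu> = {x. \<forall>U. open U \<and> x \<in> U \<longrightarrow> emeasure \<nu> U > 0}"

text \<open>A sign vector \<open>\<epsilon>\<close> acts by componentwise multiplication.\<close>

definition sign_vectors :: "(real ^ 'n) set" where
  "sign_vectors = {\<epsilon>. \<forall>i. \<epsilon> $ i \<in> {-1, 1}}"

definition sign_flip :: "real ^ 'n \<Rightarrow> real ^ 'n \<Rightarrow> real ^ 'n" where
  "sign_flip \<epsilon> x = (\<chi> i. \<epsilon> $ i * x $ i)"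

definition symmetric_fun :: "(real ^ 'n \<Rightarrow> ereal) \<Rightarrow> bool" where
  "symmetric_fun f \<longleftrightarrow> (\<forall>x. f (- x) = f x)"

definition unconditional_fun :: "(real ^ 'n \<Rightarrow> ereal) \<Rightarrow> bool" where
  "unconditional_fun f \<longleftrightarrow> (\<forall>\<epsilon> \<in> sign_vectors. \<forall>x. f (sign_flip \<epsilon> x) = f x)"

definition Ps1 :: "(real ^ 'n) measure set" where
  "Ps1 = {\<nu> \<in> P1. distr \<nu> borel uminus = \<nu>}"

definition Pu1 :: "(real ^ 'n) measure set" where
  "Pu1 = {\<nu> \<in> P1. \<forall>\<epsilon> \<in> sign_vectors. distr \<nu> borel (sign_flip \<epsilon>) = \<nu>}"

end

theory Submission
  imports Defs
begin

text \<open>The upper bound is the definition of \<open>K_Leb\<close> with the test function \<open>f\<close> itself. The real content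
  is the lower bound: a compactly supported \<open>\<nu>\<close> with the symmetries of \<open>f\<close> must be found for which
  \<open>f\<close> is a nearly optimal test function in \<open>K_Leb \<nu>\<close>. The candidate comes from reading
  \<open>L_Leb\<close> as a convex functional. Its convexity is the Prekopa-Leindler inequality
  (\<open>prekopa_leindler\<close>), and the negative of its derivative at \<open>f\<close> is integration against the moment measure of
  \<open>\<phi> = f\<^sup>*\<close>, the image of the Gibbs measure with density proportional to \<open>e\<^bsup>-\<phi>\<^esup>\<close> under the gradient of \<open>\<phi>\<close>. A convex
  function lies above its tangent, and the tangent inequality
  \<open>L(g) \<ge> L(f) - \<integral>(g - f) d\<nu>\<close> says exactly that \<open>f\<close> is optimal in \<open>K_Leb \<nu>\<close>.

  The tangent inequality may fail when \<open>\<phi>\<close> takes the value \<open>\<infinity>\<close>. So \<open>f\<close> is first set to \<open>\<infinity>\<close> outside the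
  ball of radius \<open>k\<close>. The new conjugate \<open>\<phi>\<^sub>k\<close> is finite and \<open>k\<close>-Lipschitz, and
  its gradient is bounded by \<open>k\<close>, which makes the support of the moment measure compact.
  If \<open>\<integral>e\<^bsup>-\<phi>\<^esup>\<close> is positive and finite then \<open>0\<close> is interior to the domain of \<open>f\<close>
  (\<open>zero_in_interior_domain\<close>); hence \<open>\<phi>\<^sub>k\<close> grows at least linearly, \<open>e\<^bsup>-\<phi>\<^sub>k\<^esup>\<close> is integrable, and its integral
  tends to that of \<open>e\<^bsup>-\<phi>\<^esup>\<close> as \<open>k\<close> grows (\<open>truncated_integral_tendsto\<close>).
  If the integral is infinite, \<open>L_Leb f = -\<infinity>\<close> and the upper bound suffices.

  The gradient is replaced by the point \<open>x\<close> at which \<open>\<phi>\<^sub>k y = sup (x \<bullet> y - f x)\<close> is attained. It exists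
  by compactness and lower semicontinuity, and it is unique for almost every \<open>y\<close>, because the integral against
  \<open>e\<^bsup>-\<phi>\<^sub>k\<^esup>\<close> of the second differences of \<open>\<phi>\<^sub>k\<close> vanishes in the limit
  (\<open>AE_unique_maximizer\<close>). Uniqueness gives measurability of the maximizer and makes it
  commute with every reflection that preserves \<open>f\<close>, so the moment measure inherits
  the symmetries of \<open>f\<close> (\<open>distr_moment_measure_reflection\<close>). The derivative at \<open>f\<close> is
  taken inside \<open>integral_le_exp_integral\<close>, where the Prekopa-Leindler inequality with weight \<open>t\<close> is divided by
  \<open>t\<close> and \<open>t\<close> tends to \<open>0\<close>.\<close>

section \<open>The Prekopa-Leindler inequality\<close>

lemma emeasure_lborel_vimage_diff:
  fixes A :: "real set"
  assumes "A \<in> sets borel"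
  shows "emeasure lborel ((\<lambda>x. x - c) -` A) = emeasure lborel A"
proof -
  have [measurable]: "A \<in> sets borel" by fact
  have m: "(\<lambda>x. x - c) -` A \<in> sets borel"
    using measurable_sets_borel[of "\<lambda>x. x - c" borel A] assms by auto
  have "emeasure lborel ((\<lambda>x. x - c) -` A) = emeasure (distr lborel borel ((+) c)) ((\<lambda>x. x - c) -` A)"
    by (simp add: lborel_distr_plus)
  also have "\<dots> = emeasure lborel ((+) c -` ((\<lambda>x. x - c) -` A) \<inter> space lborel)"
    using m by (intro emeasure_distr) auto
  also have "(+) c -` ((\<lambda>x. x - c) -` A) \<inter> space lborel = A" by auto
  finally show ?thesis .
qed

text \<open>Take \<open>a \<in> A\<close> near the supremum of \<open>A\<close> and \<open>b \<in> B\<close> near the infimum of \<open>B\<close>. The part of \<open>A\<close> below \<open>a\<close>,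
  shifted by \<open>b\<close>, and the part of \<open>B\<close> above \<open>b\<close>, shifted by \<open>a\<close>, both lie in \<open>C\<close> and are separated by the
  point \<open>a + b\<close>; what they leave out of \<open>A\<close> and \<open>B\<close> has arbitrarily small measure.\<close>

lemma brunn_minkowski_real:
  fixes A B C :: "real set"
  assumes [measurable]: "A \<in> sets borel" "B \<in> sets borel" "C \<in> sets borel"
    and "A \<noteq> {}" "B \<noteq> {}" "bdd_above A" "bdd_below B"
    and sum: "\<And>a b. a \<in> A \<Longrightarrow> b \<in> B \<Longrightarrow> a + b \<in> C"
  shows "emeasure lborel A + emeasure lborel B \<le> emeasure lborel C"
proof (rule ennreal_le_epsilon)
  fix e :: real assume "0 < e"
  define d where "d = e / 2"
  have d: "0 < d" using \<open>0 < e\<close> by (simp add: d_def)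
  obtain a where a: "a \<in> A" "Sup A - d < a"
    using less_cSup_iff[of A "Sup A - d"] assms d by auto
  obtain b where b: "b \<in> B" "b < Inf B + d"
    using cInf_less_iff[of B "Inf B + d"] assms d by auto
  define A' where "A' = A \<inter> {..<a}"
  define B' where "B' = B \<inter> {b..}"
  have [measurable]: "A' \<in> sets borel" "B' \<in> sets borel" by (auto simp: A'_def B'_def)
  have "emeasure lborel A \<le> emeasure lborel (A' \<union> {a..a+d})"
    using a cSup_upper[OF _ \<open>bdd_above A\<close>] by (intro emeasure_mono) (force simp: A'_def)+
  also have "\<dots> \<le> emeasure lborel A' + emeasure lborel {a..a+d}"
    by (rule emeasure_subadditive) auto
  finally have A: "emeasure lborel A \<le> emeasure lborel A' + ennreal d" using d by simp
  have "emeasure lborel B \<le> emeasure lborel (B' \<union> {b-d..b})"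
    using b cInf_lower[OF _ \<open>bdd_below B\<close>] by (intro emeasure_mono) (force simp: B'_def)+
  also have "\<dots> \<le> emeasure lborel B' + emeasure lborel {b-d..b}"
    by (rule emeasure_subadditive) auto
  finally have B: "emeasure lborel B \<le> emeasure lborel B' + ennreal d" using d by simp
  let ?A = "(\<lambda>x. x - b) -` A'" and ?B = "(\<lambda>x. x - a) -` B'"
  have mA: "?A \<in> sets borel" using measurable_sets_borel[of "\<lambda>x. x - b" borel A'] by auto
  have mB: "?B \<in> sets borel" using measurable_sets_borel[of "\<lambda>x. x - a" borel B'] by auto
  have "?A \<inter> ?B = {}" by (auto simp: A'_def B'_def)
  moreover have "?A \<union> ?B \<subseteq> C"
    using sum[OF _ b(1)] sum[OF a(1)] by (auto simp: A'_def B'_def) (metis diff_add_cancel, metis add_diff_cancel_left' diff_add_cancel add.commute)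
  ultimately have "emeasure lborel ?A + emeasure lborel ?B \<le> emeasure lborel C"
    using mA mB by (subst plus_emeasure) (auto intro!: emeasure_mono)
  then have "emeasure lborel A' + emeasure lborel B' \<le> emeasure lborel C"
    by (simp add: emeasure_lborel_vimage_diff)
  moreover have "ennreal e = ennreal d + ennreal d"
    using d by (simp add: d_def flip: ennreal_plus)
  moreover have "emeasure lborel A + emeasure lborel B
      \<le> (emeasure lborel A' + ennreal d) + (emeasure lborel B' + ennreal d)"
    using A B by (rule add_mono)
  moreover have "\<dots> = (emeasure lborel A' + emeasure lborel B') + (ennreal d + ennreal d)"
    by (simp add: ac_simps)
  ultimately show "emeasure lborel A + emeasure lborel B \<le> emeasure lborel C + ennreal e"
    by (metis add_right_mono order_trans)
qed

lemma emeasure_lborel_vimage_divide: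
  fixes A :: "real set"
  assumes [measurable]: "A \<in> sets borel" and c: "c > 0"
  shows "emeasure lborel ((\<lambda>x. x / c) -` A) = ennreal c * emeasure lborel A"
proof -
  have m: "(\<lambda>x. x / c) -` A \<in> sets borel"
    using measurable_sets_borel[of "\<lambda>x. x / c" borel A] by auto
  have "emeasure lborel ((\<lambda>x. x / c) -` A) = (\<integral>\<^sup>+x. indicator ((\<lambda>x. x / c) -` A) x \<partial>lborel)"
    using m by simp
  also have "\<dots> = ennreal c * (\<integral>\<^sup>+x. indicator ((\<lambda>x. x / c) -` A) (0 + c * x) \<partial>lborel)"
    using nn_integral_real_affine[of "indicator ((\<lambda>x. x / c) -` A)" c 0] m c by simp
  also have "(\<lambda>x. indicator ((\<lambda>x. x / c) -` A) (0 + c * x)) = (indicator A :: real \<Rightarrow> ennreal)"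
    using c by (auto simp: indicator_def fun_eq_iff)
  finally show ?thesis by simp
qed

lemma nn_integral_layer_cake_unit:
  fixes u :: "real \<Rightarrow> real"
  assumes [measurable]: "u \<in> borel_measurable borel" and "\<And>x. 0 \<le> u x" "\<And>x. u x \<le> 1"
  shows "(\<integral>\<^sup>+x. ennreal (u x) \<partial>lborel)
    = (\<integral>\<^sup>+s. indicator {0<..<1} s * emeasure lborel {x. s < u x} \<partial>lborel)"
proof -
  have "ennreal (u x) = (\<integral>\<^sup>+s. indicator {0<..<1} s * indicator {s. s < u x} s \<partial>lborel)" for x
  proof -
    have "(\<integral>\<^sup>+s. indicator {0<..<1} s * indicator {s. s < u x} s \<partial>lborel)
        = (\<integral>\<^sup>+s. indicator {0<..<u x} s \<partial>lborel)"
      using assms(3)[of x] by (intro nn_integral_cong) (auto simp: indicator_def)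
    then show ?thesis using assms(2)[of x] by simp
  qed
  then have "(\<integral>\<^sup>+x. ennreal (u x) \<partial>lborel)
     = (\<integral>\<^sup>+x. \<integral>\<^sup>+s. indicator {0<..<1} s * indicator {s. s < u x} s \<partial>lborel \<partial>lborel)" by simp
  also have "\<dots> = (\<integral>\<^sup>+s. \<integral>\<^sup>+x. indicator {0<..<1} s * indicator {s. s < u x} s \<partial>lborel \<partial>lborel)"
    by (rule lborel_pair.Fubini'[symmetric]) (simp add: indicator_def, measurable)
  also have "\<dots> = (\<integral>\<^sup>+s. indicator {0<..<1} s * emeasure lborel {x. s < u x} \<partial>lborel)"
  proof (intro nn_integral_cong)
    fix s
    have "(\<integral>\<^sup>+x. indicator {0<..<1} s * indicator {s. s < u x} s \<partial>lborel)
       = (\<integral>\<^sup>+x. indicator {0<..<1} s * indicator {x. s < u x} x \<partial>lborel)"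
      by (intro nn_integral_cong) (auto simp: indicator_def)
    then show "(\<integral>\<^sup>+x. indicator {0<..<1} s * indicator {s. s < u x} s \<partial>lborel)
       = indicator {0<..<1} s * emeasure lborel {x. s < u x}"
      by (simp add: nn_integral_cmult)
  qed
  finally show ?thesis .
qed

text \<open>Only an inequality, because the levels stop at \<open>1\<close> while \<open>h\<close> may exceed \<open>1\<close>.\<close>

lemma nn_integral_layer_cake_unit_le:
  fixes h :: "real \<Rightarrow> ennreal"
  assumes [measurable]: "h \<in> borel_measurable borel"
  shows "(\<integral>\<^sup>+s. indicator {0<..<1} s * emeasure lborel {x. ennreal s < h x} \<partial>lborel)
    \<le> (\<integral>\<^sup>+x. h x \<partial>lborel)"
proof -
  define u where "u x = enn2real (min 1 (h x))" for x
  have [measurable]: "u \<in> borel_measurable borel" unfolding u_def by measurable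
  have fin: "min 1 (h x) < top" for x by (simp add: min_less_iff_disj)
  have u: "ennreal (u x) = min 1 (h x)" for x unfolding u_def using fin[of x] by simp
  have u01: "0 \<le> u x" "u x \<le> 1" for x
    using u[of x] by (auto simp: u_def ennreal_le_1[symmetric] simp del: ennreal_le_1)
  have "s < u x \<longleftrightarrow> ennreal s < h x" if "0 < s" "s < 1" for s x
  proof -
    have "s < u x \<longleftrightarrow> ennreal s < ennreal (u x)" using that by (simp add: ennreal_less_iff)
    also have "\<dots> \<longleftrightarrow> ennreal s < h x" using that by (simp add: u ennreal_less_one_iff)
    finally show ?thesis .
  qed
  then have "(\<integral>\<^sup>+s. indicator {0<..<1} s * emeasure lborel {x. ennreal s < h x} \<partial>lborel)
     = (\<integral>\<^sup>+s. indicator {0<..<1} s * emeasure lborel {x. s < u x} \<partial>lborel)"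
    by (intro nn_integral_cong) (auto simp: indicator_def)
  also have "\<dots> = (\<integral>\<^sup>+x. ennreal (u x) \<partial>lborel)"
    by (rule nn_integral_layer_cake_unit[symmetric]) (auto simp: u01)
  also have "\<dots> \<le> (\<integral>\<^sup>+x. h x \<partial>lborel)" by (intro nn_integral_mono) (simp add: u)
  finally show ?thesis .
qed

text \<open>Since both suprema are \<open>1\<close>, the superlevel sets of \<open>u\<close> and \<open>v\<close> are nonempty at every level \<open>s < 1\<close>, and
  the superlevel set of \<open>h\<close> at \<open>s\<close> contains \<open>(1 - t){u > s} + t{v > s}\<close>. The Brunn-Minkowski inequality
  at each level, integrated over \<open>s\<close>, gives even the arithmetic mean of the integrals.\<close>

lemma prekopa_leindler_real_normalized:
  fixes u v :: "real \<Rightarrow> real" and h :: "real \<Rightarrow> ennreal"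
  assumes [measurable]: "u \<in> borel_measurable borel" "v \<in> borel_measurable borel" "h \<in> borel_measurable borel"
    and u: "\<And>x. 0 \<le> u x" "\<And>x. u x \<le> 1" "\<And>s. s < 1 \<Longrightarrow> \<exists>x. s < u x"
    and v: "\<And>x. 0 \<le> v x" "\<And>x. v x \<le> 1" "\<And>s. s < 1 \<Longrightarrow> \<exists>x. s < v x"
    and supp: "\<And>x. u x \<noteq> 0 \<Longrightarrow> \<bar>x\<bar> \<le> R" "\<And>x. v x \<noteq> 0 \<Longrightarrow> \<bar>x\<bar> \<le> R"
    and t: "0 < t" "t < 1"
    and h: "\<And>x y. ennreal (u x powr (1 - t) * v y powr t) \<le> h ((1 - t) * x + t * y)"
  shows "ennreal (1 - t) * (\<integral>\<^sup>+x. u x \<partial>lborel) + ennreal t * (\<integral>\<^sup>+x. v x \<partial>lborel) \<le> (\<integral>\<^sup>+x. h x \<partial>lborel)"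
proof -
  have level: "ennreal (1 - t) * emeasure lborel {x. s < u x} + ennreal t * emeasure lborel {x. s < v x}
      \<le> emeasure lborel {x. ennreal s < h x}" if s: "0 < s" "s < 1" for s
  proof -
    let ?A = "(\<lambda>x. x / (1 - t)) -` {x. s < u x}" and ?B = "(\<lambda>x. x / t) -` {x. s < v x}"
    have sub: "(\<lambda>x. x / c) -` {x. s < w x} \<subseteq> {- (c * R) .. c * R}"
      if "0 < c" "\<And>x. w x \<noteq> 0 \<Longrightarrow> \<bar>x\<bar> \<le> R" for c and w :: "real \<Rightarrow> real"
    proof
      fix x assume "x \<in> (\<lambda>x. x / c) -` {x. s < w x}"
      then have "w (x / c) \<noteq> 0" using s by auto
      then have "\<bar>x / c\<bar> \<le> R" by (rule that(2))
      then have "\<bar>x\<bar> \<le> c * R" using that(1) by (simp add: abs_divide field_simps)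
      then show "x \<in> {- (c * R) .. c * R}" by auto
    qed
    have "emeasure lborel ?A + emeasure lborel ?B \<le> emeasure lborel {x. ennreal s < h x}"
    proof (rule brunn_minkowski_real)
      show "?A \<in> sets borel" "?B \<in> sets borel"
        using measurable_sets_borel[of "\<lambda>x. x / (1 - t)" borel "{x. s < u x}"]
          measurable_sets_borel[of "\<lambda>x. x / t" borel "{x. s < v x}"] by auto
      obtain x y where "s < u x" "s < v y" using u(3) v(3) s by blast
      then have "(1 - t) * x \<in> ?A" "t * y \<in> ?B" using t by auto
      then show "?A \<noteq> {}" "?B \<noteq> {}" by blast+
      show "bdd_above ?A" "bdd_below ?B" 
        using sub[of "1 - t" u] sub[of t v] supp t bdd_above_mono bdd_below_mono
        by (auto intro: bdd_above_mono bdd_below_mono)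
      fix a b assume "a \<in> ?A" "b \<in> ?B"
      then have "s powr (1-t) * s powr t < u (a / (1-t)) powr (1-t) * v (b / t) powr t"
        using s t by (intro mult_strict_mono powr_less_mono2) auto
      moreover have "s powr (1-t) * s powr t = s" using s by (simp flip: powr_add)
      ultimately have "ennreal s < ennreal (u (a / (1-t)) powr (1-t) * v (b / t) powr t)"
        using s by (simp add: ennreal_less_iff)
      also have "\<dots> \<le> h (a + b)" using h[of "a / (1-t)" "b / t"] t by simp
      finally show "a + b \<in> {x. ennreal s < h x}" by simp
    qed auto
    then show ?thesis
      using t emeasure_lborel_vimage_divide[of "{x. s < u x}" "1 - t"]
        emeasure_lborel_vimage_divide[of "{x. s < v x}" t] by simp
  qed
  have "ennreal (1 - t) * (\<integral>\<^sup>+x. u x \<partial>lborel) + ennreal t * (\<integral>\<^sup>+x. v x \<partial>lborel)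
     = (\<integral>\<^sup>+s. indicator {0<..<1} s * (ennreal (1 - t) * emeasure lborel {x. s < u x}
            + ennreal t * emeasure lborel {x. s < v x}) \<partial>lborel)"
    using u v
    by (simp add: nn_integral_layer_cake_unit distrib_left nn_integral_add nn_integral_cmult[symmetric] mult.left_commute
      del: nn_integral_cmult)
  also have "\<dots> \<le> (\<integral>\<^sup>+s. indicator {0<..<1} s * emeasure lborel {x. ennreal s < h x} \<partial>lborel)"
    using level by (intro nn_integral_mono) (auto simp: indicator_def)
  also have "\<dots> \<le> (\<integral>\<^sup>+x. h x \<partial>lborel)" by (rule nn_integral_layer_cake_unit_le) simp
  finally show ?thesis .
qed

lemma
  fixes w :: "'a \<Rightarrow> real"
  assumes [measurable]: "w \<in> borel_measurable M" "A \<in> sets M"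
    and A: "emeasure M A < \<infinity>"
    and w: "\<And>x. x \<in> space M \<Longrightarrow> 0 \<le> w x" "\<And>x. x \<in> space M \<Longrightarrow> w x \<le> B"
    and supp: "\<And>x. x \<in> space M \<Longrightarrow> w x \<noteq> 0 \<Longrightarrow> x \<in> A"
  shows integrable_bounded_support: "integrable M w"
    and integral_bounded_support_le: "(\<integral>x. w x \<partial>M) \<le> B * measure M A"
proof -
  have i: "integrable M (\<lambda>x. B * indicator A x :: real)"
    using A by (intro integrable_mult_right integrable_real_indicator) auto
  have le: "w x \<le> B * indicator A x" if "x \<in> space M" for x
    using w[OF that] supp[OF that] by (auto simp: indicator_def)
  show "integrable M w"
    using order_trans[OF le abs_ge_self] w by (intro Bochner_Integration.integrable_bound[OF i] AE_I2) auto
  then have "(\<integral>x. w x \<partial>M) \<le> (\<integral>x. B * indicator A x \<partial>M)"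
    using i le by (intro integral_mono) auto
  then show "(\<integral>x. w x \<partial>M) \<le> B * measure M A" using A by simp
qed

text \<open>Dividing by the suprema reduces this to the normalized case, and the weighted inequality between
  arithmetic and geometric means returns to products of powers.\<close>

lemma prekopa_leindler_real_bounded:
  fixes u v :: "real \<Rightarrow> real" and h :: "real \<Rightarrow> ennreal"
  assumes [measurable]: "u \<in> borel_measurable borel" "v \<in> borel_measurable borel" "h \<in> borel_measurable borel"
    and u: "\<And>x. 0 \<le> u x" "\<And>x. u x \<le> B"
    and v: "\<And>x. 0 \<le> v x" "\<And>x. v x \<le> B"
    and supp: "\<And>x. u x \<noteq> 0 \<Longrightarrow> \<bar>x\<bar> \<le> R" "\<And>x. v x \<noteq> 0 \<Longrightarrow> \<bar>x\<bar> \<le> R"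
    and t: "0 < t" "t < 1"
    and h: "\<And>x y. ennreal (u x powr (1 - t) * v y powr t) \<le> h ((1 - t) * x + t * y)"
  shows "ennreal ((\<integral>x. u x \<partial>lborel) powr (1 - t) * (\<integral>x. v x \<partial>lborel) powr t) \<le> (\<integral>\<^sup>+x. h x \<partial>lborel)"
proof (cases "(\<forall>x. u x = 0) \<or> (\<forall>x. v x = 0)")
  case True
  then show ?thesis by auto
next
  case False
  define a where "a = (SUP x. u x)"
  define b where "b = (SUP x. v x)"
  have bu: "bdd_above (range u)" and bv: "bdd_above (range v)" using u v by (auto intro!: bdd_aboveI)
  have ua: "u x \<le> a" and vb: "v x \<le> b" for x
    unfolding a_def b_def using cSUP_upper[OF _ bu] cSUP_upper[OF _ bv] by auto
  obtain x0 y0 where "u x0 \<noteq> 0" "v y0 \<noteq> 0" using False by blast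
  then have ab: "0 < a" "0 < b" using ua[of x0] vb[of y0] u(1)[of x0] v(1)[of y0] by linarith+
  have iu: "integrable lborel u" and iv: "integrable lborel v"
    using u v supp
    by (auto intro!: integrable_bounded_support[where A="{-R..R}" and B=B] simp: emeasure_lborel_Icc_eq abs_le_iff minus_le_iff)
  define M where "M = a powr (1 - t) * b powr t"
  have M: "0 < M" using ab by (simp add: M_def)
  let ?U = "\<integral>x. u x \<partial>lborel" and ?V = "\<integral>x. v x \<partial>lborel"
  have UV: "0 \<le> ?U" "0 \<le> ?V" using u v by auto
  have "ennreal (1 - t) * (\<integral>\<^sup>+x. u x / a \<partial>lborel) + ennreal t * (\<integral>\<^sup>+x. v x / b \<partial>lborel)
     \<le> (\<integral>\<^sup>+x. ennreal (1 / M) * h x \<partial>lborel)"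
  proof (rule prekopa_leindler_real_normalized[where R=R])
    fix s :: real assume "s < 1"
    then have "s * a < a" "s * b < b" using ab by auto
    then show "\<exists>x. s < u x / a" "\<exists>x. s < v x / b"
      unfolding a_def[symmetric] b_def[symmetric]
      using less_cSUP_iff[OF _ bu, of "s * a"] less_cSUP_iff[OF _ bv, of "s * b"] ab
      by (auto simp: a_def[symmetric] b_def[symmetric] field_simps)
  next
    fix x y
    have "ennreal ((u x / a) powr (1 - t) * (v y / b) powr t)
        = ennreal (1 / M * (u x powr (1 - t) * v y powr t))"
      using ab u v by (simp add: powr_divide M_def)
    also have "\<dots> = ennreal (1 / M) * ennreal (u x powr (1 - t) * v y powr t)"
      using M by (intro ennreal_mult) auto
    also have "\<dots> \<le> ennreal (1 / M) * h ((1 - t) * x + t * y)" by (intro mult_left_mono h) auto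
    finally show "ennreal ((u x / a) powr (1 - t) * (v y / b) powr t) \<le> ennreal (1 / M) * h ((1 - t) * x + t * y)" .
  qed (use u v ua vb ab supp t in auto)
  also have "(\<integral>\<^sup>+x. u x / a \<partial>lborel) = ennreal (?U / a)"
    using iu u ab by (subst nn_integral_eq_integral) auto
  also have "(\<integral>\<^sup>+x. v x / b \<partial>lborel) = ennreal (?V / b)"
    using iv v ab by (subst nn_integral_eq_integral) auto
  also have "ennreal (1 - t) * ennreal (?U / a) + ennreal t * ennreal (?V / b)
     = ennreal ((1 - t) * (?U / a) + t * (?V / b))"
    using t UV ab by (simp add: ennreal_mult'[symmetric])
  finally have *: "ennreal ((1 - t) * (?U / a) + t * (?V / b)) \<le> ennreal (1 / M) * (\<integral>\<^sup>+x. h x \<partial>lborel)"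
    by (simp add: nn_integral_cmult)
  have "(?U / a) powr (1 - t) * (?V / b) powr t \<le> (1 - t) * (?U / a) + t * (?V / b)"
  proof (cases "?U = 0 \<or> ?V = 0")
    case True
    then show ?thesis using UV t ab by auto
  next
    case False
    then show ?thesis using UV t ab by (intro Youngs_inequality_0) auto
  qed
  then have "?U powr (1 - t) * ?V powr t \<le> M * ((1 - t) * (?U / a) + t * (?V / b))"
    using M UV ab by (simp add: powr_divide M_def field_simps)
  then have "ennreal (?U powr (1 - t) * ?V powr t) \<le> ennreal M * ennreal ((1 - t) * (?U / a) + t * (?V / b))"
    using M by (simp add: ennreal_mult'[symmetric] ennreal_leI)
  also have "\<dots> \<le> ennreal M * (ennreal (1 / M) * (\<integral>\<^sup>+x. h x \<partial>lborel))"
    using * by (rule mult_left_mono) simp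
  also have "\<dots> = (\<integral>\<^sup>+x. h x \<partial>lborel)"
    using M by (simp add: mult.assoc[symmetric] ennreal_mult'[symmetric])
  finally show ?thesis .
qed


text \<open>Induction on the number of coordinates: the one-dimensional inequality in the coordinate \<open>i\<close> shows that
  the integrals over the slices of \<open>u\<close>, \<open>v\<close> and \<open>h\<close> satisfy the hypothesis in the remaining coordinates. A
  bound on the functions together with a bounded support passes to these integrals and keeps them finite.\<close>

lemma prekopa_leindler_PiM_bounded:
  fixes u v :: "('i \<Rightarrow> real) \<Rightarrow> real" and h :: "('i \<Rightarrow> real) \<Rightarrow> ennreal"
  assumes "finite I"
    and "u \<in> borel_measurable (PiM I (\<lambda>_. lborel))" "v \<in> borel_measurable (PiM I (\<lambda>_. lborel))"
      "h \<in> borel_measurable (PiM I (\<lambda>_. lborel))"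
    and "\<And>x. x \<in> extensional I \<Longrightarrow> 0 \<le> u x" "\<And>x. x \<in> extensional I \<Longrightarrow> u x \<le> B"
    and "\<And>x. x \<in> extensional I \<Longrightarrow> 0 \<le> v x" "\<And>x. x \<in> extensional I \<Longrightarrow> v x \<le> B"
    and "\<And>x i. x \<in> extensional I \<Longrightarrow> u x \<noteq> 0 \<Longrightarrow> i \<in> I \<Longrightarrow> \<bar>x i\<bar> \<le> R"
      "\<And>x i. x \<in> extensional I \<Longrightarrow> v x \<noteq> 0 \<Longrightarrow> i \<in> I \<Longrightarrow> \<bar>x i\<bar> \<le> R"
    and t: "0 < t" "t < 1"
    and "\<And>x y. x \<in> extensional I \<Longrightarrow> y \<in> extensional I \<Longrightarrow>
      ennreal (u x powr (1 - t) * v y powr t) \<le> h (\<lambda>i\<in>I. (1 - t) * x i + t * y i)"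
  shows "ennreal ((\<integral>x. u x \<partial>PiM I (\<lambda>_. lborel)) powr (1 - t) * (\<integral>x. v x \<partial>PiM I (\<lambda>_. lborel)) powr t)
    \<le> (\<integral>\<^sup>+x. h x \<partial>PiM I (\<lambda>_. lborel))"
  using assms(1-10) assms(13)
proof (induction I arbitrary: u v h B)
  case empty
  have [simp]: "integral\<^sup>L (count_space {\<lambda>_. undefined}) w = w (\<lambda>_. undefined)" for w :: "('i \<Rightarrow> real) \<Rightarrow> real"
    by (subst lebesgue_integral_count_space_finite) auto
  show ?case
    using empty.prems(10)[of "\<lambda>_. undefined" "\<lambda>_. undefined"]
    by (simp add: PiM_empty nn_integral_count_space_finite restrict_def)
next
  case (insert i I)
  interpret product_sigma_finite "\<lambda>_::'i. lborel :: real measure" ..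
  let ?P = "\<lambda>I. PiM I (\<lambda>_::'i. lborel :: real measure)"
  note [measurable] = insert.prems(1-3)
  have sp: "space (?P J) = extensional J" for J by (simp add: space_PiM PiE_def)
  have upd: "x(i := s) \<in> extensional (insert i I)" if "x \<in> extensional I" for x s
    using that by (auto simp: extensional_def)
  have slice: "(\<lambda>s. w (x(i := s))) \<in> borel_measurable borel"
    if "w \<in> borel_measurable (?P (insert i I))" "x \<in> extensional I" for w :: "_ \<Rightarrow> 'c::topological_space" and x
    using measurable_compose[OF measurable_component_update[of x I "\<lambda>_. lborel" i] that(1)] that(2) insert.hyps
    by (simp add: sp)
  define U where "U x = (\<integral>s. u (x(i := s)) \<partial>lborel)" for x
  define V where "V x = (\<integral>s. v (x(i := s)) \<partial>lborel)" for x
  define H where "H x = (\<integral>\<^sup>+s. h (x(i := s)) \<partial>lborel)" for x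
  have int: "integrable (?P (insert i I)) w \<and> (\<integral>x. w x \<partial>?P (insert i I)) = (\<integral>x. \<integral>s. w (x(i := s)) \<partial>lborel \<partial>?P I)"
    if [measurable]: "w \<in> borel_measurable (?P (insert i I))"
      and "\<And>x. x \<in> extensional (insert i I) \<Longrightarrow> 0 \<le> w x" "\<And>x. x \<in> extensional (insert i I) \<Longrightarrow> w x \<le> B"
      and "\<And>x j. x \<in> extensional (insert i I) \<Longrightarrow> w x \<noteq> 0 \<Longrightarrow> j \<in> insert i I \<Longrightarrow> \<bar>x j\<bar> \<le> R" for w
  proof -
    have "integrable (?P (insert i I)) w"
    proof (rule integrable_bounded_support[where A="PiE (insert i I) (\<lambda>_. {-R..R})" and B=B])
      show "emeasure (?P (insert i I)) (PiE (insert i I) (\<lambda>_. {-R..R})) < \<infinity>"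
        using insert.hyps by (subst emeasure_PiM) (auto simp: emeasure_lborel_Icc_eq ennreal_mult_less_top ennreal_power[symmetric] power_less_top_ennreal)
      fix x assume "x \<in> space (?P (insert i I))" "w x \<noteq> 0"
      with that(4)[of x] show "x \<in> PiE (insert i I) (\<lambda>_. {-R..R})"
        by (auto simp: sp PiE_def abs_le_iff minus_le_iff)
    qed (use insert.hyps that(2,3) in \<open>auto simp: sp intro!: sets_PiM_I_finite\<close>)
    with product_integral_insert[OF insert.hyps this] show ?thesis by simp
  qed
  have slice_le: "0 \<le> (\<integral>s. w (x(i := s)) \<partial>lborel) \<and> (\<integral>s. w (x(i := s)) \<partial>lborel) \<le> B * measure lborel {-R..R}
      \<and> ((\<integral>s. w (x(i := s)) \<partial>lborel) \<noteq> 0 \<longrightarrow> j \<in> I \<longrightarrow> \<bar>x j\<bar> \<le> R)"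
    if "w \<in> borel_measurable (?P (insert i I))" and x: "x \<in> extensional I"
      and w: "\<And>x. x \<in> extensional (insert i I) \<Longrightarrow> 0 \<le> w x" "\<And>x. x \<in> extensional (insert i I) \<Longrightarrow> w x \<le> B"
      and supp: "\<And>x j. x \<in> extensional (insert i I) \<Longrightarrow> w x \<noteq> 0 \<Longrightarrow> j \<in> insert i I \<Longrightarrow> \<bar>x j\<bar> \<le> R" for w x j
  proof (intro conjI impI)
    have s: "\<bar>s\<bar> \<le> R" if "w (x(i := s)) \<noteq> 0" for s
      using supp[OF upd[OF x] that, of i] by simp
    show "0 \<le> (\<integral>s. w (x(i := s)) \<partial>lborel)" using w(1)[OF upd[OF x]] by simp
    show "(\<integral>s. w (x(i := s)) \<partial>lborel) \<le> B * measure lborel {-R..R}"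
      using slice[OF that(1) x] w upd[OF x] s
      by (intro integral_bounded_support_le) (auto simp: emeasure_lborel_Icc_eq abs_le_iff minus_le_iff)
    assume "(\<integral>s. w (x(i := s)) \<partial>lborel) \<noteq> 0" "j \<in> I"
    then obtain s where "w (x(i := s)) \<noteq> 0" by (metis (mono_tags, lifting) Bochner_Integration.integral_cong integral_zero)
    then show "\<bar>x j\<bar> \<le> R" using supp[OF upd[OF x], of s j] \<open>j \<in> I\<close> insert.hyps by (auto split: if_splits)
  qed
  note wu = insert.prems(1,4,5,8) and wv = insert.prems(2,6,7,9)
  have sU: "0 \<le> U x \<and> U x \<le> B * measure lborel {-R..R} \<and> (U x \<noteq> 0 \<longrightarrow> j \<in> I \<longrightarrow> \<bar>x j\<bar> \<le> R)"
    if "x \<in> extensional I" for x j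
    unfolding U_def by (rule slice_le) (use wu that in auto)
  have sV: "0 \<le> V x \<and> V x \<le> B * measure lborel {-R..R} \<and> (V x \<noteq> 0 \<longrightarrow> j \<in> I \<longrightarrow> \<bar>x j\<bar> \<le> R)"
    if "x \<in> extensional I" for x j
    unfolding V_def by (rule slice_le) (use wv that in auto)
  have "ennreal ((\<integral>x. U x \<partial>?P I) powr (1 - t) * (\<integral>x. V x \<partial>?P I) powr t) \<le> (\<integral>\<^sup>+x. H x \<partial>?P I)"
  proof (rule insert.IH)
    show "U \<in> borel_measurable (?P I)" "V \<in> borel_measurable (?P I)" "H \<in> borel_measurable (?P I)"
      unfolding U_def V_def H_def by measurable
  next
    fix x y :: "'i \<Rightarrow> real" assume x: "x \<in> extensional I" and y: "y \<in> extensional I"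
    show "ennreal (U x powr (1 - t) * V y powr t) \<le> H (\<lambda>j\<in>I. (1 - t) * x j + t * y j)"
      unfolding U_def V_def H_def
    proof (rule prekopa_leindler_real_bounded[where R=R and B=B])
      fix r s
      have "ennreal (u (x(i := r)) powr (1 - t) * v (y(i := s)) powr t)
         \<le> h (\<lambda>j\<in>insert i I. (1 - t) * (x(i := r)) j + t * (y(i := s)) j)"
        by (intro insert.prems upd x y)
      also have "(\<lambda>j\<in>insert i I. (1 - t) * (x(i := r)) j + t * (y(i := s)) j)
         = (\<lambda>j\<in>I. (1 - t) * x j + t * y j)(i := (1 - t) * r + t * s)"
        using insert.hyps by (auto simp: fun_eq_iff)
      finally show "ennreal (u (x(i := r)) powr (1 - t) * v (y(i := s)) powr t)
         \<le> h ((\<lambda>j\<in>I. (1 - t) * x j + t * y j)(i := (1 - t) * r + t * s))" .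
    next
      show "(\<lambda>s. u (x(i := s))) \<in> borel_measurable borel" "(\<lambda>s. v (y(i := s))) \<in> borel_measurable borel"
        "(\<lambda>s. h ((\<lambda>j\<in>I. (1 - t) * x j + t * y j)(i := s))) \<in> borel_measurable borel"
        using x y by (auto intro!: slice)
      show "\<bar>s\<bar> \<le> R" if "u (x(i := s)) \<noteq> 0" for s using wu(4)[OF upd[OF x] that, of i] by simp
      show "\<bar>s\<bar> \<le> R" if "v (y(i := s)) \<noteq> 0" for s using wv(4)[OF upd[OF y] that, of i] by simp
    qed (use wu wv upd x y t in auto)
  qed (use sU sV in auto)
  moreover have "(\<integral>x. u x \<partial>?P (insert i I)) = (\<integral>x. U x \<partial>?P I)"
    unfolding U_def by (rule conjunct2[OF int]) (use wu in auto)
  moreover have "(\<integral>x. v x \<partial>?P (insert i I)) = (\<integral>x. V x \<partial>?P I)"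
    unfolding V_def by (rule conjunct2[OF int]) (use wv in auto)
  ultimately show ?case
    using insert.hyps by (simp add: H_def product_nn_integral_insert)
qed


lemma prekopa_leindler_bounded:
  fixes u v :: "'a::euclidean_space \<Rightarrow> real" and h :: "'a \<Rightarrow> ennreal"
  assumes [measurable]: "u \<in> borel_measurable borel" "v \<in> borel_measurable borel" "h \<in> borel_measurable borel"
    and u: "\<And>x. 0 \<le> u x" "\<And>x. u x \<le> B"
    and v: "\<And>x. 0 \<le> v x" "\<And>x. v x \<le> B"
    and supp: "\<And>x b. u x \<noteq> 0 \<Longrightarrow> b \<in> Basis \<Longrightarrow> \<bar>x \<bullet> b\<bar> \<le> R" "\<And>x b. v x \<noteq> 0 \<Longrightarrow> b \<in> Basis \<Longrightarrow> \<bar>x \<bullet> b\<bar> \<le> R"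
    and t: "0 < t" "t < 1"
    and h: "\<And>x y. ennreal (u x powr (1 - t) * v y powr t) \<le> h ((1 - t) *\<^sub>R x + t *\<^sub>R y)"
  shows "ennreal ((\<integral>x. u x \<partial>lborel) powr (1 - t) * (\<integral>x. v x \<partial>lborel) powr t) \<le> (\<integral>\<^sup>+x. h x \<partial>lborel)"
proof -
  let ?P = "PiM Basis (\<lambda>_::'a. lborel :: real measure)"
  define T :: "('a \<Rightarrow> real) \<Rightarrow> 'a" where "T x = (\<Sum>b\<in>Basis. x b *\<^sub>R b)" for x
  have [measurable]: "T \<in> measurable ?P borel" unfolding T_def by measurable
  have lb: "lborel = distr ?P borel T" unfolding T_def by (rule lborel_eq)
  have T: "T x \<bullet> b = x b" if "b \<in> Basis" for x b
    using that unfolding T_def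
    by (simp add: inner_sum_left inner_Basis if_distrib if_distribR sum.delta cong: if_cong)
  have "ennreal ((\<integral>x. u (T x) \<partial>?P) powr (1 - t) * (\<integral>x. v (T x) \<partial>?P) powr t) \<le> (\<integral>\<^sup>+x. h (T x) \<partial>?P)"
  proof (rule prekopa_leindler_PiM_bounded[where R=R and B=B])
    fix x y
    have "T (\<lambda>i\<in>Basis. (1 - t) * x i + t * y i) = (1 - t) *\<^sub>R T x + t *\<^sub>R T y"
      by (rule euclidean_eqI) (simp add: T inner_add_left)
    then show "ennreal (u (T x) powr (1 - t) * v (T y) powr t) \<le> h (T (\<lambda>i\<in>Basis. (1 - t) * x i + t * y i))"
      using h by simp
  next
    show "\<bar>x b\<bar> \<le> R" if "u (T x) \<noteq> 0" "b \<in> Basis" for x b using supp(1)[OF that] T[OF that(2)] by simp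
    show "\<bar>x b\<bar> \<le> R" if "v (T x) \<noteq> 0" "b \<in> Basis" for x b using supp(2)[OF that] T[OF that(2)] by simp
  qed (use u v t in auto)
  then show ?thesis by (simp add: lb integral_distr nn_integral_distr)
qed

text \<open>Cutting \<open>u\<close> and \<open>v\<close> off at height \<open>n\<close> and outside a box of size \<open>n\<close> only weakens the hypothesis on \<open>h\<close>;
  the general case follows by dominated convergence.\<close>

theorem prekopa_leindler:
  fixes u v :: "'a::euclidean_space \<Rightarrow> real" and h :: "'a \<Rightarrow> ennreal"
  assumes int: "integrable lborel u" "integrable lborel v"
    and [measurable]: "h \<in> borel_measurable borel"
    and nonneg: "\<And>x. 0 \<le> u x" "\<And>x. 0 \<le> v x"
    and t: "0 < t" "t < 1"
    and h: "\<And>x y. ennreal (u x powr (1 - t) * v y powr t) \<le> h ((1 - t) *\<^sub>R x + t *\<^sub>R y)"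
  shows "ennreal ((\<integral>x. u x \<partial>lborel) powr (1 - t) * (\<integral>x. v x \<partial>lborel) powr t) \<le> (\<integral>\<^sup>+x. h x \<partial>lborel)"
proof -
  define cut where "cut w n x = (if \<forall>b\<in>Basis. \<bar>x \<bullet> b\<bar> \<le> real n then min (w x) (real n) else 0)"
    for w :: "'a \<Rightarrow> real" and n x
  have cut: "cut w n \<in> borel_measurable borel" "0 \<le> cut w n x" "cut w n x \<le> w x" "cut w n x \<le> real n"
    "cut w n x \<noteq> 0 \<Longrightarrow> b \<in> Basis \<Longrightarrow> \<bar>x \<bullet> b\<bar> \<le> real n"
    "(\<lambda>n. \<integral>x. cut w n x \<partial>lborel) \<longlonglongrightarrow> (\<integral>x. w x \<partial>lborel)"
    if w: "integrable lborel w" "\<And>x. 0 \<le> w x" for w n x b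
  proof -
    have [measurable]: "w \<in> borel_measurable borel" using w(1) by auto
    show m[measurable]: "cut w n \<in> borel_measurable borel" for n unfolding cut_def by measurable
    show bd: "0 \<le> cut w n x" "cut w n x \<le> w x" "cut w n x \<le> real n" for n x using w(2) by (auto simp: cut_def)
    show "cut w n x \<noteq> 0 \<Longrightarrow> b \<in> Basis \<Longrightarrow> \<bar>x \<bullet> b\<bar> \<le> real n" by (auto simp: cut_def split: if_splits)
    have lim: "(\<lambda>n. cut w n x) \<longlonglongrightarrow> w x" for x
    proof (rule tendsto_eventually)
      obtain N where "max (norm x) (w x) \<le> real N" using real_arch_simple by blast
      then have "eventually (\<lambda>n. norm x \<le> real n \<and> w x \<le> real n) sequentially"
        by (intro eventually_sequentiallyI[of N]) simp
      then show "eventually (\<lambda>n. cut w n x = w x) sequentially"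
        by eventually_elim (auto simp: cut_def intro: order_trans[OF Basis_le_norm])
    qed
    show "(\<lambda>n. \<integral>x. cut w n x \<partial>lborel) \<longlonglongrightarrow> (\<integral>x. w x \<partial>lborel)"
      by (rule integral_dominated_convergence[where w=w]) (use w lim bd in auto)
  qed
  let ?I = "\<lambda>u v. (\<integral>x. u x \<partial>lborel) powr (1 - t) * (\<integral>x. v x \<partial>lborel) powr t"
  have "ennreal (?I (cut u n) (cut v n)) \<le> (\<integral>\<^sup>+x. h x \<partial>lborel)" for n
  proof (rule prekopa_leindler_bounded[where B="real n" and R="real n"])
    fix x y
    have "cut u n x powr (1 - t) * cut v n y powr t \<le> u x powr (1 - t) * v y powr t"
      using cut(2,3)[OF int(1) nonneg(1)] cut(2,3)[OF int(2) nonneg(2)] t by (intro mult_mono powr_mono2) auto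
    then show "ennreal (cut u n x powr (1 - t) * cut v n y powr t) \<le> h ((1 - t) *\<^sub>R x + t *\<^sub>R y)"
      using h[of x y] ennreal_leI order_trans by blast
  qed (use cut[OF int(1) nonneg(1)] cut[OF int(2) nonneg(2)] t in auto)
  moreover have "(\<lambda>n. ennreal (?I (cut u n) (cut v n))) \<longlonglongrightarrow> ennreal (?I u v)"
    using t cut(2)[OF int(1) nonneg(1)] cut(2)[OF int(2) nonneg(2)]
    by (intro tendsto_ennrealI tendsto_mult tendsto_powr' tendsto_const cut int nonneg)
      (auto intro!: always_eventually integral_nonneg)
  ultimately show ?thesis by (meson LIMSEQ_le_const2)
qed

section \<open>Integration on Euclidean space\<close>

lemma abs_exp_minus_one_le:
  fixes u :: real
  shows "\<bar>exp u - 1\<bar> \<le> \<bar>u\<bar> * exp (max u 0)"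
proof (cases "u \<ge> 0")
  case True
  have "exp u * (1 + - u) \<le> exp u * exp (- u)" by (intro mult_left_mono exp_ge_add_one_self) auto
  then show ?thesis using True by (simp add: algebra_simps exp_minus max_def)
next
  case False
  then have eq: "max u 0 = 0" "\<bar>u\<bar> = - u" "\<bar>exp u - 1\<bar> = 1 - exp u" by auto
  show ?thesis unfolding eq exp_zero mult_1_right using exp_ge_add_one_self[of u] by linarith
qed

text \<open>With the \<open>l\<^sup>1\<close>-norm in the exponent the integrand is a product of functions of one coordinate each.\<close>

lemma integrable_exp_minus_l1:
  assumes "0 < c"
  shows "integrable lborel (\<lambda>y::'a::euclidean_space. exp (- c * (\<Sum>b\<in>Basis. \<bar>y \<bullet> b\<bar>)))"
proof (rule integrableI_nonneg)
  have 1: "(\<integral>\<^sup>+s. ennreal (exp (- c * \<bar>s\<bar>)) \<partial>lborel) < \<infinity>"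
  proof -
    have half: "(\<integral>\<^sup>+s. ennreal (exp (- c * s)) * indicator {0..} s \<partial>lborel) = ennreal (0 - (- exp (- c * 0) / c))"
    proof (rule nn_integral_FTC_atLeast)
      show "((\<lambda>s. - exp (- c * s) / c) \<longlongrightarrow> 0) at_top" using assms by real_asymp
    qed (use assms in \<open>auto intro!: derivative_eq_intros\<close>)
    have "(\<integral>\<^sup>+s. ennreal (exp (- c * \<bar>s\<bar>)) \<partial>lborel)
      \<le> (\<integral>\<^sup>+s. ennreal (exp (- c * s)) * indicator {0..} s + ennreal (exp (- c * (0 + -1 * s))) * indicator {0..} (0 + -1 * s) \<partial>lborel)"
      by (intro nn_integral_mono) (auto simp: indicator_def)
    also have "\<dots> = (\<integral>\<^sup>+s. ennreal (exp (- c * s)) * indicator {0..} s \<partial>lborel)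
       + (\<integral>\<^sup>+s. ennreal (exp (- c * (0 + -1 * s))) * indicator {0..} (0 + -1 * s) \<partial>lborel)"
      by (rule nn_integral_add) auto
    also have "(\<integral>\<^sup>+s. ennreal (exp (- c * (0 + -1 * s))) * indicator {0..} (0 + -1 * s) \<partial>lborel)
       = (\<integral>\<^sup>+s. ennreal (exp (- c * s)) * indicator {0..} s \<partial>lborel)"
      by (subst (2) nn_integral_real_affine[where c="-1" and t=0]) auto
    finally show ?thesis unfolding half by (auto simp: less_top[symmetric] top_unique)
  qed
  have eq: "exp (- c * (\<Sum>b\<in>Basis. \<bar>y \<bullet> b\<bar>)) = (\<Prod>b\<in>Basis. exp (- c * \<bar>y \<bullet> b\<bar>))" for y :: 'a
    by (simp only: sum_distrib_left exp_sum finite_Basis)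
  have "(\<integral>\<^sup>+y. ennreal (exp (- c * (\<Sum>b\<in>Basis. \<bar>y \<bullet> b\<bar>))) \<partial>(lborel::'a measure))
     = (\<integral>\<^sup>+y. (\<Prod>b\<in>Basis. ennreal (exp (- c * \<bar>y \<bullet> b\<bar>))) \<partial>(lborel::'a measure))"
    by (intro nn_integral_cong) (simp only: eq prod_ennreal exp_ge_zero)
  also have "\<dots> = (\<Prod>b\<in>(Basis::'a set). (\<integral>\<^sup>+s. ennreal (exp (- c * \<bar>s\<bar>)) \<partial>lborel))"
    by (rule nn_integral_lborel_prod) auto
  also have "\<dots> < \<infinity>"
    using 1 by (simp add: power_less_top_ennreal)
  finally show "(\<integral>\<^sup>+y. ennreal (exp (- c * (\<Sum>b\<in>Basis. \<bar>y \<bullet> b\<bar>))) \<partial>(lborel::'a measure)) < \<infinity>" .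
qed measurable

lemma
  fixes w :: "'a::euclidean_space \<Rightarrow> real"
  assumes "integrable lborel w"
  shows integrable_lborel_translate: "integrable lborel (\<lambda>x. w (x + c))"
    and integral_lborel_translate: "(\<integral>x. w (x + c) \<partial>lborel) = (\<integral>x. w x \<partial>lborel)"
proof -
  have [measurable]: "w \<in> borel_measurable borel" using assms by auto
  have "integrable (distr lborel borel ((+) c)) w" using assms by (simp add: lborel_distr_plus)
  then show "integrable lborel (\<lambda>x. w (x + c))" by (subst (asm) integrable_distr_eq) (auto simp: add.commute)
  have "(\<integral>x. w x \<partial>lborel) = (\<integral>x. w x \<partial>distr lborel borel ((+) c))" by (simp add: lborel_distr_plus)
  also have "\<dots> = (\<integral>x. w (c + x) \<partial>lborel)" by (rule integral_distr) auto
  finally show "(\<integral>x. w (x + c) \<partial>lborel) = (\<integral>x. w x \<partial>lborel)" by (simp add: add.commute)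
qed

section \<open>Coercive conjugates and their maximizers\<close>

text \<open>The function \<open>\<phi>\<close> is the conjugate of a function that equals \<open>F\<close> on the bounded set \<open>S\<close> and \<open>\<infinity>\<close>
  outside \<open>S\<close>. Boundedness of \<open>S\<close> makes \<open>\<phi>\<close> Lipschitz, and the linear growth of \<open>\<phi>\<close> makes
  \<open>e\<^bsup>-\<phi>\<^esup>\<close> integrable. The points of \<open>S\<close> that attain the supremum \<open>\<phi> y\<close>, the maximizers at \<open>y\<close>, are
  subgradients of \<open>\<phi>\<close> at \<open>y\<close>.\<close>

locale coercive_conjugate =
  fixes S :: "'a::euclidean_space set" and F \<phi> :: "'a \<Rightarrow> real" and k a b :: real
  assumes attained: "\<And>y. \<exists>x\<in>S. \<phi> y = x \<bullet> y - F x"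
    and upper: "\<And>x y. x \<in> S \<Longrightarrow> x \<bullet> y - F x \<le> \<phi> y"
    and bounded: "\<And>x. x \<in> S \<Longrightarrow> norm x \<le> k"
    and coercive: "0 < a" "\<And>y. a * (\<Sum>i\<in>Basis. \<bar>y \<bullet> i\<bar>) - b \<le> \<phi> y"
begin

lemma k_nonneg: "0 \<le> k"
  using attained[of 0] bounded norm_ge_zero order_trans by blast

lemma F_lower: "x \<in> S \<Longrightarrow> - \<phi> 0 \<le> F x"
  using upper[of x 0] by simp

lemma lipschitz: "\<phi> y - \<phi> z \<le> k * norm (y - z)"
proof -
  obtain x where x: "x \<in> S" "\<phi> y = x \<bullet> y - F x" using attained by blast
  have "\<phi> y - \<phi> z \<le> x \<bullet> (y - z)" using upper[OF x(1), of z] x(2) by (simp add: inner_diff_right)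
  also have "\<dots> \<le> norm x * norm (y - z)" by (rule norm_cauchy_schwarz)
  also have "\<dots> \<le> k * norm (y - z)" using bounded[OF x(1)] by (rule mult_right_mono) simp
  finally show ?thesis .
qed

lemma lipschitz_abs: "\<bar>\<phi> y - \<phi> z\<bar> \<le> k * norm (y - z)"
  using lipschitz[of y z] lipschitz[of z y] by (simp add: abs_le_iff norm_minus_commute)

lemma measurable_phi[measurable]: "\<phi> \<in> borel_measurable borel"
proof -
  have "k-lipschitz_on UNIV \<phi>"
    using lipschitz_abs k_nonneg by (intro lipschitz_onI) (auto simp: dist_norm)
  then show ?thesis
    by (intro borel_measurable_continuous_onI lipschitz_on_continuous_on)
qed

lemma integrable_exp_phi: "integrable lborel (\<lambda>y. exp (- \<phi> y))"
proof (rule Bochner_Integration.integrable_bound)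
  show "integrable lborel (\<lambda>y::'a. exp b * exp (- a * (\<Sum>i\<in>Basis. \<bar>y \<bullet> i\<bar>)))"
    using coercive(1) by (intro integrable_mult_right integrable_exp_minus_l1)
  show "AE y in lborel. norm (exp (- \<phi> y)) \<le> norm (exp b * exp (- a * (\<Sum>i\<in>Basis. \<bar>y \<bullet> i\<bar>)))"
    using coercive(2) by (auto simp flip: exp_add simp: algebra_simps)
qed measurable

lemma integrable_norm_exp_phi: "integrable lborel (\<lambda>y. exp (- \<phi> y) * norm y)"
proof (rule Bochner_Integration.integrable_bound)
  show "integrable lborel (\<lambda>y::'a. 2 / a * exp b * exp (- (a / 2) * (\<Sum>i\<in>Basis. \<bar>y \<bullet> i\<bar>)))"
    using coercive(1) by (intro integrable_mult_right integrable_exp_minus_l1) auto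
  show "AE y in lborel. norm (exp (- \<phi> y) * norm y)
      \<le> norm (2 / a * exp b * exp (- (a / 2) * (\<Sum>i\<in>Basis. \<bar>y \<bullet> i\<bar>)))"
  proof (intro AE_I2)
    fix y :: 'a
    define s where "s = (\<Sum>i\<in>Basis. \<bar>y \<bullet> i\<bar>)"
    have "norm y \<le> s" unfolding s_def by (rule norm_le_l1)
    also have "s \<le> 2 / a * exp (a / 2 * s)"
      using exp_ge_add_one_self[of "a / 2 * s"] coercive(1) by (simp add: field_simps)
    finally have "exp (- \<phi> y) * norm y \<le> exp (b - a * s) * (2 / a * exp (a / 2 * s))"
      using coercive(2)[of y] by (intro mult_mono) (auto simp: s_def)
    also have "\<dots> = 2 / a * exp b * exp (- (a / 2) * s)"
    proof -
      have "exp (b - a * s) * exp (a / 2 * s) = exp b * exp (- (a / 2) * s)"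
        unfolding exp_add[symmetric] by (rule arg_cong[where f=exp]) (simp add: field_simps)
      then show ?thesis by (metis mult.assoc mult.left_commute)
    qed
    finally show "norm (exp (- \<phi> y) * norm y)
      \<le> norm (2 / a * exp b * exp (- (a / 2) * (\<Sum>i\<in>Basis. \<bar>y \<bullet> i\<bar>)))"
      using coercive(1) by (simp add: s_def)
  qed
qed measurable

definition "total_mass = (\<integral>y. exp (- \<phi> y) \<partial>lborel)"

lemma total_mass_pos: "0 < total_mass"
proof -
  have "0 \<le> total_mass" unfolding total_mass_def by simp
  moreover have "total_mass \<noteq> 0"
  proof
    assume "total_mass = 0"
    then have "AE y in (lborel::'a measure). exp (- \<phi> y) = 0"
      using integral_nonneg_eq_0_iff_AE[OF integrable_exp_phi] by (simp add: total_mass_def)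
    then have "AE y in (lborel::'a measure). False" by simp
    then show False by (simp add: AE_iff_measurable[OF _ refl])
  qed
  ultimately show ?thesis by simp
qed

lemma nn_integral_exp_phi: "(\<integral>\<^sup>+y. ennreal (exp (- \<phi> y)) \<partial>lborel) = ennreal total_mass"
  unfolding total_mass_def by (rule nn_integral_eq_integral[OF integrable_exp_phi]) simp

text \<open>The difference between the right and the left difference quotient of \<open>\<phi>\<close> in direction \<open>e\<close>, with step
  \<open>1 / Suc j\<close>. Since \<open>x \<bullet> e\<close> lies between the two quotients for every maximizer \<open>x\<close> at \<open>y\<close>,
  maximizers are unique where these differences become small in every basis direction.\<close>

definition second_diff :: "'a \<Rightarrow> nat \<Rightarrow> 'a \<Rightarrow> real" where
  "second_diff e j y = real (Suc j) * (\<phi> (y + (1 / Suc j) *\<^sub>R e) + \<phi> (y - (1 / Suc j) *\<^sub>R e) - 2 * \<phi> y)"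

lemma second_diff_nonneg: "0 \<le> second_diff e j y"
proof -
  obtain x where x: "x \<in> S" "\<phi> y = x \<bullet> y - F x" using attained by blast
  have "0 \<le> \<phi> (y + (1 / Suc j) *\<^sub>R e) + \<phi> (y - (1 / Suc j) *\<^sub>R e) - 2 * \<phi> y"
    using upper[OF x(1), of "y + (1 / Suc j) *\<^sub>R e"] upper[OF x(1), of "y - (1 / Suc j) *\<^sub>R e"] x(2)
    by (simp add: inner_diff_right inner_add_right)
  then show ?thesis unfolding second_diff_def by simp
qed

lemma measurable_second_diff[measurable]: "second_diff e j \<in> borel_measurable borel"
  unfolding second_diff_def by measurable

text \<open>Summation by parts. After a translation one difference falls on the weight \<open>e\<^bsup>-\<phi>\<^esup>\<close>, so that the
  integrand is the product of two first differences; each of them is of the order of the step because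
  \<open>\<phi>\<close> is Lipschitz.\<close>

lemma nn_integral_second_diff_le:
  assumes e: "norm e = 1"
  shows "(\<integral>\<^sup>+y. ennreal (second_diff e j y * exp (- \<phi> y)) \<partial>lborel) \<le> ennreal (k\<^sup>2 * exp k * total_mass / real (Suc j))"
proof -
  define d where "d = 1 / real (Suc j)"
  have d: "0 < d" "d \<le> 1" by (auto simp: d_def)
  let ?w = "\<lambda>y. exp (- \<phi> y)"
  define D where "D y = \<phi> (y + d *\<^sub>R e) - \<phi> y" for y
  have [measurable]: "D \<in> borel_measurable borel" unfolding D_def by measurable
  have D: "\<bar>D y\<bar> \<le> k * d" for y
    using lipschitz_abs[of "y + d *\<^sub>R e" y] e d by (simp add: D_def)
  have bd: "integrable lborel (\<lambda>y. g y * ?w (y + c))"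
    if [measurable]: "g \<in> borel_measurable borel" and g: "\<And>y. \<bar>g y\<bar> \<le> k * d" for g c
  proof (rule Bochner_Integration.integrable_bound)
    show "integrable lborel (\<lambda>y. k * d * ?w (y + c))"
      by (intro integrable_mult_right integrable_lborel_translate integrable_exp_phi)
    show "AE y in lborel. norm (g y * ?w (y + c)) \<le> norm (k * d * ?w (y + c))"
      using g k_nonneg d by (auto intro!: AE_I2 mult_right_mono simp: abs_mult)
  qed measurable
  have i1: "integrable lborel (\<lambda>y. D y * ?w y)" using bd[of D 0] D by simp
  have i2: "integrable lborel (\<lambda>y. D y * ?w (y + d *\<^sub>R e))" using bd[of D "d *\<^sub>R e"] D by simp
  have i3: "integrable lborel (\<lambda>y. D (y - d *\<^sub>R e) * ?w y)"
    using bd[of "\<lambda>y. D (y - d *\<^sub>R e)" 0] D by simp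
  \<comment> \<open>The second difference is a difference of the first difference \<open>D\<close>, whose shifted term is moved onto the weight.\<close>
  have q: "second_diff e j y = 1 / d * (D y - D (y - d *\<^sub>R e))" for y
    by (simp add: second_diff_def D_def d_def)
  have "(\<integral>y. second_diff e j y * ?w y \<partial>lborel)
      = (\<integral>y. 1 / d * (D y * ?w y - D (y - d *\<^sub>R e) * ?w y) \<partial>lborel)"
    by (intro Bochner_Integration.integral_cong refl) (simp add: q algebra_simps)
  also have "\<dots> = 1 / d * ((\<integral>y. D y * ?w y \<partial>lborel) - (\<integral>y. D (y - d *\<^sub>R e) * ?w y \<partial>lborel))"
    by (simp only: integral_mult_right_zero Bochner_Integration.integral_diff[OF i1 i3])
  also have "(\<integral>y. D (y - d *\<^sub>R e) * ?w y \<partial>lborel) = (\<integral>y. D y * ?w (y + d *\<^sub>R e) \<partial>lborel)"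
    using integral_lborel_translate[OF i3, of "d *\<^sub>R e"] by simp
  also have "1 / d * ((\<integral>y. D y * ?w y \<partial>lborel) - (\<integral>y. D y * ?w (y + d *\<^sub>R e) \<partial>lborel))
      = 1 / d * (\<integral>y. D y * ?w y - D y * ?w (y + d *\<^sub>R e) \<partial>lborel)"
    by (simp only: Bochner_Integration.integral_diff[OF i1 i2])
  also have "\<dots> \<le> 1 / d * (\<integral>y. (k * d)\<^sup>2 * exp k * ?w y \<partial>lborel)"
  proof (intro mult_left_mono integral_mono integrable_mult_right integrable_exp_phi
      Bochner_Integration.integrable_diff i1 i2)
    fix y
    have "D y * ?w y - D y * ?w (y + d *\<^sub>R e) = D y * (- (exp (- D y) - 1)) * ?w y"
      by (simp add: D_def exp_diff exp_minus field_simps)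
    also have "\<dots> \<le> (k * d)\<^sup>2 * exp k * ?w y"
    proof (rule mult_right_mono)
      have "D y * (- (exp (- D y) - 1)) \<le> \<bar>D y\<bar> * \<bar>exp (- D y) - 1\<bar>"
        by (metis abs_ge_self abs_minus_cancel abs_mult)
      also have "\<dots> \<le> \<bar>D y\<bar> * (\<bar>- D y\<bar> * exp (max (- D y) 0))"
        by (intro mult_left_mono abs_exp_minus_one_le) simp
      also have "\<dots> \<le> (k * d) * ((k * d) * exp k)"
      proof (intro mult_mono)
        have "k * d \<le> k" using d k_nonneg by (simp add: mult_left_le)
        then show "exp (max (- D y) 0) \<le> exp k" using D[of y] k_nonneg by (simp add: abs_le_iff)
      qed (use D[of y] k_nonneg d in auto)
      finally show "D y * (- (exp (- D y) - 1)) \<le> (k * d)\<^sup>2 * exp k" by (simp add: power2_eq_square mult_ac)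
    qed simp
    finally show "D y * ?w y - D y * ?w (y + d *\<^sub>R e) \<le> (k * d)\<^sup>2 * exp k * ?w y" .
  qed (use d in simp)
  also have "\<dots> = k\<^sup>2 * exp k * total_mass * d"
    using d by (simp add: total_mass_def power2_eq_square field_simps)
  also have "\<dots> = k\<^sup>2 * exp k * total_mass / real (Suc j)" by (simp add: d_def)
  finally have "(\<integral>y. second_diff e j y * ?w y \<partial>lborel) \<le> k\<^sup>2 * exp k * total_mass / real (Suc j)" .
  moreover have "integrable lborel (\<lambda>y. second_diff e j y * ?w y)"
  proof -
    have "integrable lborel (\<lambda>y. 1 / d * (D y * ?w y - D (y - d *\<^sub>R e) * ?w y))"
      by (intro integrable_mult_right Bochner_Integration.integrable_diff i1 i3)
    then show ?thesis by (simp add: q algebra_simps)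
  qed
  ultimately show ?thesis
    using second_diff_nonneg by (subst nn_integral_eq_integral) (auto intro: ennreal_leI)
qed

text \<open>Fatou's lemma applied to the previous bound.\<close>

lemma AE_liminf_second_diff:
  assumes e: "norm e = 1"
  shows "AE y in lborel. liminf (\<lambda>j. ennreal (second_diff e j y * exp (- \<phi> y))) = 0"
proof -
  have "(\<integral>\<^sup>+y. liminf (\<lambda>j. ennreal (second_diff e j y * exp (- \<phi> y))) \<partial>lborel)
     \<le> liminf (\<lambda>j. \<integral>\<^sup>+y. ennreal (second_diff e j y * exp (- \<phi> y)) \<partial>lborel)"
    by (rule nn_integral_liminf) measurable
  also have "\<dots> \<le> liminf (\<lambda>j. ennreal (k\<^sup>2 * exp k * total_mass / real (Suc j)))"
    using nn_integral_second_diff_le[OF e] by (intro Liminf_mono always_eventually) auto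
  also have "\<dots> = 0"
  proof (rule lim_imp_Liminf)
    have "(\<lambda>j. k\<^sup>2 * exp k * total_mass / real (Suc j)) \<longlonglongrightarrow> 0"
      by (rule LIMSEQ_Suc[OF lim_const_over_n])
    then show "(\<lambda>j. ennreal (k\<^sup>2 * exp k * total_mass / real (Suc j))) \<longlonglongrightarrow> 0"
      using tendsto_ennrealI by fastforce
  qed simp
  finally show ?thesis by (subst (asm) le_zero_eq, subst (asm) nn_integral_0_iff_AE) measurable
qed

text \<open>The coordinates are the right partial derivatives of the convex function \<open>\<phi>\<close>. Writing them
  as infima of countably many difference quotients makes the map measurable on the whole space; it picks out the
  maximizer wherever that is unique.\<close>

definition maximizer :: "'a \<Rightarrow> 'a" where
  "maximizer y = (\<Sum>e\<in>Basis. (INF j. real (Suc j) * (\<phi> (y + (1 / Suc j) *\<^sub>R e) - \<phi> y)) *\<^sub>R e)"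

lemma measurable_maximizer[measurable]: "maximizer \<in> borel_measurable borel"
  unfolding maximizer_def by measurable

lemma maximizer_inner_Basis: "e \<in> Basis \<Longrightarrow> maximizer y \<bullet> e = (INF j. real (Suc j) * (\<phi> (y + (1 / Suc j) *\<^sub>R e) - \<phi> y))"
  unfolding maximizer_def
  by (simp add: inner_sum_left inner_Basis if_distrib if_distribR sum.delta cong: if_cong)

lemma diff_quotient_abs_le:
  assumes "e \<in> Basis"
  shows "\<bar>real (Suc j) * (\<phi> (y + (1 / Suc j) *\<^sub>R e) - \<phi> y)\<bar> \<le> k"
proof -
  have "\<bar>\<phi> (y + (1 / Suc j) *\<^sub>R e) - \<phi> y\<bar> \<le> k * (1 / Suc j)"
    using lipschitz_abs[of "y + (1 / Suc j) *\<^sub>R e" y] assms by simp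
  then have "real (Suc j) * \<bar>\<phi> (y + (1 / Suc j) *\<^sub>R e) - \<phi> y\<bar> \<le> real (Suc j) * (k * (1 / Suc j))"
    by (rule mult_left_mono) simp
  also have "\<dots> = k" by simp
  finally show ?thesis unfolding abs_mult by simp
qed

lemma norm_maximizer_le: "norm (maximizer y) \<le> real DIM('a) * k"
proof -
  have "\<bar>maximizer y \<bullet> e\<bar> \<le> k" if "e \<in> Basis" for e
  proof -
    let ?r = "\<lambda>j. real (Suc j) * (\<phi> (y + (1 / Suc j) *\<^sub>R e) - \<phi> y)"
    have r: "- k \<le> ?r j" "?r j \<le> k" for j using diff_quotient_abs_le[OF that, of j y] by (auto simp: abs_le_iff)
    have "- k \<le> (INF j. ?r j)" using r by (intro cINF_greatest) auto
    moreover have "(INF j. ?r j) \<le> ?r 0"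
      using r by (intro cINF_lower bdd_belowI2[where m="-k"]) auto
    moreover note r(2)[of 0]
    ultimately show ?thesis using that unfolding maximizer_inner_Basis[OF that] by linarith
  qed
  then have "(\<Sum>e\<in>Basis. \<bar>maximizer y \<bullet> e\<bar>) \<le> (\<Sum>e\<in>(Basis::'a set). k)" by (rule sum_mono)
  with norm_le_l1[of "maximizer y"] show ?thesis by simp
qed

text \<open>Each coordinate of a maximizer is at most every right difference quotient and at least the
  corresponding left one. So it misses the infimum of the right quotients by at most the second
  difference, for every step, and the limit inferior of these vanishes almost everywhere.\<close>

lemma AE_unique_maximizer: "AE y in lborel. \<forall>x\<in>S. \<phi> y = x \<bullet> y - F x \<longrightarrow> x = maximizer y"
proof -
  have "AE y in lborel. \<forall>e\<in>Basis. liminf (\<lambda>j. ennreal (second_diff e j y * exp (- \<phi> y))) = 0"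
    using AE_liminf_second_diff by (subst AE_ball_countable) (auto simp: countable_finite)
  then show ?thesis
  proof (rule AE_mp, intro AE_I2 impI ballI)
    fix y x assume lim: "\<forall>e\<in>Basis. liminf (\<lambda>j. ennreal (second_diff e j y * exp (- \<phi> y))) = 0"
      and x: "x \<in> S" "\<phi> y = x \<bullet> y - F x"
    show "x = maximizer y"
    proof (rule euclidean_eqI)
      fix e :: 'a assume e: "e \<in> Basis"
      let ?r = "\<lambda>j. real (Suc j) * (\<phi> (y + (1 / Suc j) *\<^sub>R e) - \<phi> y)"
      have r: "x \<bullet> e \<le> ?r j" for j
      proof -
        have "x \<bullet> e / real (Suc j) \<le> \<phi> (y + (1 / Suc j) *\<^sub>R e) - \<phi> y"
          using upper[OF x(1), of "y + (1 / Suc j) *\<^sub>R e"] x(2) by (simp add: inner_add_right)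
        then show ?thesis by (subst (asm) pos_divide_le_eq) (simp_all only: mult.commute of_nat_0_less_iff zero_less_Suc)
      qed
      have l: "real (Suc j) * (\<phi> y - \<phi> (y - (1 / Suc j) *\<^sub>R e)) \<le> x \<bullet> e" for j
      proof -
        have "\<phi> y - \<phi> (y - (1 / Suc j) *\<^sub>R e) \<le> x \<bullet> e / real (Suc j)"
          using upper[OF x(1), of "y - (1 / Suc j) *\<^sub>R e"] x(2) by (simp add: inner_diff_right)
        then show ?thesis by (subst (asm) pos_le_divide_eq) (simp_all only: mult.commute of_nat_0_less_iff zero_less_Suc)
      qed
      have "(INF j. ?r j) \<le> x \<bullet> e"
      proof (rule ccontr)
        assume "\<not> ?thesis"
        then have pos: "0 < (INF j. ?r j) - x \<bullet> e" by simp
        have "(INF j. ?r j) \<le> ?r j" for j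
          using r by (intro cINF_lower bdd_belowI2[where m="x \<bullet> e"]) auto
        then have "(INF j. ?r j) - x \<bullet> e \<le> second_diff e j y" for j
          using l[of j] by (smt (verit) second_diff_def right_diff_distrib distrib_left)
        then have "liminf (\<lambda>j. ennreal (second_diff e j y * exp (- \<phi> y))) \<ge> ennreal (((INF j. ?r j) - x \<bullet> e) * exp (- \<phi> y))"
          by (intro Liminf_bounded always_eventually allI ennreal_leI mult_right_mono) auto
        then show False using lim e pos by (auto simp: ennreal_eq_0_iff mult_le_0_iff not_le[symmetric])
      qed
      moreover have "x \<bullet> e \<le> (INF j. ?r j)" using r by (intro cINF_greatest) auto
      ultimately show "x \<bullet> e = maximizer y \<bullet> e" using e by (simp add: maximizer_inner_Basis)
    qed
  qed
qed

lemma AE_maximizer: "AE y in lborel. maximizer y \<in> S \<and> \<phi> y = maximizer y \<bullet> y - F (maximizer y)"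
  using AE_unique_maximizer by eventually_elim (use attained in metis)

end

section \<open>The tangent inequality at the Gibbs measure\<close>

lemma exp_difference_quotient_tendsto:
  "(\<lambda>n. (exp (d / real (n + 2)) - 1) * real (n + 2)) \<longlonglongrightarrow> (d::real)"
proof -
  have "((\<lambda>t. exp (t * d)) has_field_derivative d) (at 0)"
    by (auto intro!: derivative_eq_intros)
  then have "((\<lambda>t. (exp (t * d) - 1) / t) \<longlongrightarrow> d) (at 0)"
    by (simp add: has_field_derivative_iff)
  moreover have "filterlim (\<lambda>n. 1 / real (n + 2)) (at 0) sequentially"
    by real_asymp
  ultimately have "((\<lambda>n. (exp (1 / real (n + 2) * d) - 1) / (1 / real (n + 2))) \<longlongrightarrow> d) sequentially"
    by (rule filterlim_compose)
  then show ?thesis by simp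
qed

context coercive_conjugate
begin

definition gibbs :: "'a measure" where "gibbs = density lborel (\<lambda>y. ennreal (exp (- \<phi> y) / total_mass))"

lemma sets_gibbs[simp, measurable_cong]: "sets gibbs = sets borel" and space_gibbs[simp]: "space gibbs = UNIV"
  by (simp_all add: gibbs_def)

lemma prob_space_gibbs: "prob_space gibbs"
proof
  have "emeasure gibbs (space gibbs) = (\<integral>\<^sup>+y. ennreal (exp (- \<phi> y) / total_mass) \<partial>lborel)"
    by (simp add: gibbs_def emeasure_density)
  also have "\<dots> = ennreal (\<integral>y. exp (- \<phi> y) / total_mass \<partial>lborel)"
    using total_mass_pos integrable_exp_phi by (intro nn_integral_eq_integral) auto
  also have "\<dots> = 1" using total_mass_pos by (simp add: total_mass_def)
  finally show "emeasure gibbs (space gibbs) = 1" .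
qed

lemma AE_gibbs_iff: "(AE y in gibbs. P y) \<longleftrightarrow> (AE y in lborel. P y)"
  unfolding gibbs_def using total_mass_pos by (subst AE_density) auto

lemma
  fixes w :: "'a \<Rightarrow> real"
  assumes [measurable]: "w \<in> borel_measurable borel"
  shows integrable_gibbs_iff: "integrable gibbs w \<longleftrightarrow> integrable lborel (\<lambda>y. exp (- \<phi> y) * w y)"
    and integral_gibbs: "(\<integral>y. w y \<partial>gibbs) = (\<integral>y. exp (- \<phi> y) * w y \<partial>lborel) / total_mass"
proof -
  have eq: "exp (- \<phi> y) / total_mass * w y = 1 / total_mass * (exp (- \<phi> y) * w y)" for y by simp
  show "integrable gibbs w \<longleftrightarrow> integrable lborel (\<lambda>y. exp (- \<phi> y) * w y)"
    using total_mass_pos unfolding gibbs_def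
    by (subst integrable_density) (simp_all only: eq real_scaleR_def integrable_mult_left_iff, simp_all)
  show "(\<integral>y. w y \<partial>gibbs) = (\<integral>y. exp (- \<phi> y) * w y \<partial>lborel) / total_mass"
    using total_mass_pos unfolding gibbs_def by (subst integral_density) auto
qed

text \<open>Agrees with \<open>F (maximizer y)\<close> almost everywhere, and is measurable although \<open>F\<close> need not be.\<close>

definition F_maximizer :: "'a \<Rightarrow> real" where "F_maximizer y = maximizer y \<bullet> y - \<phi> y"

lemma measurable_F_maximizer[measurable]: "F_maximizer \<in> borel_measurable borel"
  unfolding F_maximizer_def by measurable

lemma AE_F_maximizer: "AE y in lborel. maximizer y \<in> S \<and> F (maximizer y) = F_maximizer y"
  using AE_maximizer by eventually_elim (simp add: F_maximizer_def)

lemma integrable_F_maximizer: "integrable gibbs F_maximizer"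
proof -
  interpret prob_space gibbs by (rule prob_space_gibbs)
  have "integrable gibbs norm"
    using integrable_norm_exp_phi by (simp add: integrable_gibbs_iff)
  then have "integrable gibbs (\<lambda>y. (real DIM('a) + 1) * k * norm y + \<bar>\<phi> 0\<bar>)" by simp
  then show ?thesis
  proof (rule Bochner_Integration.integrable_bound)
    show "AE y in gibbs. norm (F_maximizer y) \<le> norm ((real DIM('a) + 1) * k * norm y + \<bar>\<phi> 0\<bar>)"
    proof (intro AE_I2)
      fix y
      have "\<bar>maximizer y \<bullet> y\<bar> \<le> real DIM('a) * k * norm y"
        using Cauchy_Schwarz_ineq2[of "maximizer y" y] norm_maximizer_le[of y] mult_right_mono[OF norm_maximizer_le[of y], of "norm y"]
        by simp
      moreover have "\<bar>\<phi> y\<bar> \<le> k * norm y + \<bar>\<phi> 0\<bar>" using lipschitz_abs[of y 0] by simp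
      ultimately have "\<bar>F_maximizer y\<bar> \<le> (real DIM('a) + 1) * k * norm y + \<bar>\<phi> 0\<bar>"
        by (simp add: F_maximizer_def algebra_simps)
      then show "norm (F_maximizer y) \<le> norm ((real DIM('a) + 1) * k * norm y + \<bar>\<phi> 0\<bar>)" by simp
    qed
  qed simp
qed

text \<open>The tangent inequality in integrated form. For \<open>v = e\<^bsup>-g\<^sup>*\<^esup>\<close> and \<open>D = g \<circ> maximizer - F_maximizer\<close> the pointwise
  hypothesis is the inequality between \<open>g\<close> and its conjugate \<open>g\<^sup>*\<close>.

  The function \<open>exp (- \<phi> + t D)\<close> dominates the geometric mean of \<open>e\<^bsup>-\<phi>\<^esup>\<close> and \<open>v\<close> in the sense of the
  Prekopa-Leindler inequality, since at the maximizer of the intermediate point the inequality for \<open>\<phi>\<close>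
  and the hypothesis on \<open>v\<close> add up. So \<open>(\<integral>v / total_mass) powr t\<close> is at most the Gibbs average of
  \<open>exp (t D)\<close>; taking logarithms, dividing by \<open>t\<close> and letting \<open>t\<close> tend to \<open>0\<close> leaves the average of \<open>D\<close>.
  The upper bound on \<open>D\<close> provides the dominating function for this limit.\<close>

lemma integral_le_exp_integral:
  fixes v D :: "'a \<Rightarrow> real"
  assumes v: "integrable lborel v" "\<And>b. 0 \<le> v b"
    and D: "integrable gibbs D" "AE y in gibbs. D y \<le> C"
    and le: "AE y in lborel. \<forall>b. v b \<le> exp (D y + F_maximizer y - maximizer y \<bullet> b)"
  shows "(\<integral>b. v b \<partial>lborel) \<le> total_mass * exp (\<integral>y. D y \<partial>gibbs)"
proof (cases "(\<integral>b. v b \<partial>lborel) = 0")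
  case True
  then show ?thesis using total_mass_pos by simp
next
  case False
  interpret prob_space gibbs by (rule prob_space_gibbs)
  have [measurable]: "D \<in> borel_measurable borel" using borel_measurable_integrable[OF D(1)] by simp
  let ?V = "\<integral>b. v b \<partial>lborel"
  have "0 \<le> ?V" using v(2) by simp
  with False have V: "0 < ?V" by simp
  have "AE y in lborel. maximizer y \<in> S \<and> F (maximizer y) = F_maximizer y \<and> (\<forall>b. v b \<le> exp (D y + F_maximizer y - maximizer y \<bullet> b))"
    using AE_F_maximizer le by eventually_elim simp
  then obtain N where N: "N \<in> null_sets lborel"
    and "{y \<in> space lborel. \<not> (maximizer y \<in> S \<and> F (maximizer y) = F_maximizer y \<and> (\<forall>b. v b \<le> exp (D y + F_maximizer y - maximizer y \<bullet> b)))} \<subseteq> N"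
    unfolding eventually_ae_filter by blast
  then have notN: "maximizer y \<in> S \<and> F (maximizer y) = F_maximizer y \<and> (\<forall>b. v b \<le> exp (D y + F_maximizer y - maximizer y \<bullet> b))" if "y \<notin> N" for y
    using that by (simp add: subset_eq) blast
  have [measurable]: "N \<in> sets borel" using N by auto
  have int_exp: "integrable gibbs (\<lambda>y. exp (t * D y))" if "0 < t" "t < 1" for t
  proof (rule Bochner_Integration.integrable_bound)
    show "integrable gibbs (\<lambda>y. exp (max C 0))" by simp
    show "AE y in gibbs. norm (exp (t * D y)) \<le> norm (exp (max C 0))"
      using D(2)
    proof eventually_elim
      case (elim y)
      have "t * D y \<le> t * max C 0" using elim that by (intro mult_left_mono) auto
      also have "\<dots> \<le> 1 * max C 0" using that by (intro mult_right_mono) auto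
      finally show ?case by simp
    qed
  qed simp
  have PL: "(?V / total_mass) powr t \<le> (\<integral>y. exp (t * D y) \<partial>gibbs)" if t: "0 < t" "t < 1" for t
  proof -
    \<comment> \<open>The exponential dominates only where the maximizer is attained; the value \<open>top\<close> on the null set \<open>N\<close>
      makes the hypothesis of the Prekopa-Leindler inequality hold at every point.\<close>
    define h where "h y = (if y \<in> N then top else ennreal (exp (- \<phi> y + t * D y)))" for y
    have "ennreal ((\<integral>y. exp (- \<phi> y) \<partial>lborel) powr (1 - t) * ?V powr t) \<le> (\<integral>\<^sup>+y. h y \<partial>lborel)"
    proof (rule prekopa_leindler)
      show "h \<in> borel_measurable borel" unfolding h_def by measurable
      fix x y :: 'a
      define z where "z = (1 - t) *\<^sub>R x + t *\<^sub>R y"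
      show "ennreal (exp (- \<phi> x) powr (1 - t) * v y powr t) \<le> h ((1 - t) *\<^sub>R x + t *\<^sub>R y)"
      proof (cases "z \<in> N")
        case True
        then show ?thesis by (simp add: h_def z_def)
      next
        case False
        have 1: "exp (- \<phi> x) \<le> exp (F_maximizer z - maximizer z \<bullet> x)"
          using notN[OF False] upper[of "maximizer z" x] by simp
        have 2: "v y \<le> exp (D z + F_maximizer z - maximizer z \<bullet> y)" using notN[OF False] by blast
        have "exp (- \<phi> x) powr (1 - t) * v y powr t
            \<le> exp (F_maximizer z - maximizer z \<bullet> x) powr (1 - t) * exp (D z + F_maximizer z - maximizer z \<bullet> y) powr t"
          using 1 2 t v(2) by (intro mult_mono powr_mono2) auto
        also have "\<dots> = exp ((1 - t) * (F_maximizer z - maximizer z \<bullet> x) + t * (D z + F_maximizer z - maximizer z \<bullet> y))"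
          by (simp add: powr_def exp_add)
        also have "(1 - t) * (F_maximizer z - maximizer z \<bullet> x) + t * (D z + F_maximizer z - maximizer z \<bullet> y) = F_maximizer z - maximizer z \<bullet> z + t * D z"
          by (simp add: z_def inner_add_right algebra_simps)
        also have "\<dots> = - \<phi> z + t * D z" by (simp add: F_maximizer_def)
        finally show ?thesis using False by (simp add: h_def z_def ennreal_leI)
      qed
    qed (use v t integrable_exp_phi in auto)
    also have "(\<integral>\<^sup>+y. h y \<partial>lborel) = (\<integral>\<^sup>+y. ennreal (exp (- \<phi> y + t * D y)) \<partial>lborel)"
      using AE_not_in[OF N] by (intro nn_integral_cong_AE) (auto simp: h_def)
    also have "\<dots> = ennreal (\<integral>y. exp (- \<phi> y + t * D y) \<partial>lborel)"
      using int_exp[OF t] by (intro nn_integral_eq_integral) (auto simp: integrable_gibbs_iff simp flip: exp_add)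
    also have "(\<integral>y. exp (- \<phi> y + t * D y) \<partial>lborel) = total_mass * (\<integral>y. exp (t * D y) \<partial>gibbs)"
      using total_mass_pos by (simp add: integral_gibbs flip: exp_add)
    finally have "total_mass powr (1 - t) * ?V powr t \<le> total_mass * (\<integral>y. exp (t * D y) \<partial>gibbs)"
      using total_mass_pos by (subst (asm) ennreal_le_iff) (auto simp: total_mass_def[symmetric])
    moreover have "total_mass powr (1 - t) * ?V powr t = total_mass * (?V / total_mass) powr t"
      using total_mass_pos V by (simp add: powr_divide powr_diff)
    ultimately show ?thesis using total_mass_pos by simp
  qed
  have bound: "ln (?V / total_mass) \<le> (\<integral>y. (exp (D y / real (n + 2)) - 1) * real (n + 2) \<partial>gibbs)" for n
  proof -
    define t where "t = 1 / real (n + 2)"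
    have t: "0 < t" "t < 1" by (auto simp: t_def)
    have "1 + t * ln (?V / total_mass) \<le> (?V / total_mass) powr t"
      using V total_mass_pos exp_ge_add_one_self[of "t * ln (?V / total_mass)"] by (simp add: powr_def mult.commute)
    also have "\<dots> \<le> (\<integral>y. exp (t * D y) \<partial>gibbs)" by (rule PL[OF t])
    finally have "t * ln (?V / total_mass) \<le> (\<integral>y. exp (t * D y) \<partial>gibbs) - 1" by simp
    also have "\<dots> = (\<integral>y. exp (t * D y) - 1 \<partial>gibbs)"
      using int_exp[OF t] prob_space by simp
    finally have "t * ln (?V / total_mass) / t \<le> (\<integral>y. exp (t * D y) - 1 \<partial>gibbs) / t"
      using t by (intro divide_right_mono) auto
    then show ?thesis using t by (simp add: t_def)
  qed
  have "(\<lambda>n. \<integral>y. (exp (D y / real (n + 2)) - 1) * real (n + 2) \<partial>gibbs) \<longlonglongrightarrow> (\<integral>y. D y \<partial>gibbs)"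
  proof (rule integral_dominated_convergence[where w="\<lambda>y. \<bar>D y\<bar> * exp (max C 0)"])
    show "AE y in gibbs. (\<lambda>n. (exp (D y / real (n + 2)) - 1) * real (n + 2)) \<longlonglongrightarrow> D y"
      by (intro AE_I2 exp_difference_quotient_tendsto)
    fix n
    show "AE y in gibbs. norm ((exp (D y / real (n + 2)) - 1) * real (n + 2)) \<le> \<bar>D y\<bar> * exp (max C 0)"
      using D(2)
    proof eventually_elim
      case (elim y)
      have "D y / real (n + 2) \<le> max C 0 / real (n + 2)" using elim by (intro divide_right_mono) auto
      also have "\<dots> \<le> max C 0 / 1" by (intro divide_left_mono) auto
      finally have "max (D y / real (n + 2)) 0 \<le> max C 0" by simp
      then have "\<bar>exp (D y / real (n + 2)) - 1\<bar> \<le> \<bar>D y / real (n + 2)\<bar> * exp (max C 0)"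
        by (intro order_trans[OF abs_exp_minus_one_le] mult_left_mono) auto
      then have "\<bar>exp (D y / real (n + 2)) - 1\<bar> * \<bar>real (n + 2)\<bar>
          \<le> \<bar>D y / real (n + 2)\<bar> * exp (max C 0) * \<bar>real (n + 2)\<bar>"
        by (rule mult_right_mono) simp
      also have "\<dots> = \<bar>D y\<bar> * exp (max C 0)" by (simp add: abs_divide)
      finally show ?case unfolding real_norm_def abs_mult .
    qed
  qed (use D in auto)
  then have "ln (?V / total_mass) \<le> (\<integral>y. D y \<partial>gibbs)"
    using bound by (intro LIMSEQ_le_const) auto
  then have "exp (ln (?V / total_mass)) \<le> exp (\<integral>y. D y \<partial>gibbs)" by simp
  then have "?V / total_mass \<le> exp (\<integral>y. D y \<partial>gibbs)" using V total_mass_pos by simp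
  then show ?thesis using total_mass_pos by (simp add: field_simps)
qed

end

section \<open>The moment measure\<close>

lemma
  fixes g :: "'a \<Rightarrow> ereal"
  assumes g: "g \<in> ereal_L1 M"
  shows ereal_L1_AE_finite: "AE x in M. g x = ereal (real_of_ereal (g x))"
    and ereal_L1_integrable: "integrable M (\<lambda>x. real_of_ereal (g x))"
    and ereal_integral_uminus_L1: "ereal_integral M (\<lambda>x. - g x) = ereal (- (\<integral>x. real_of_ereal (g x) \<partial>M))"
proof -
  have [measurable]: "g \<in> borel_measurable M" and fin: "(\<integral>\<^sup>+x. e2ennreal \<bar>g x\<bar> \<partial>M) < \<infinity>"
    using g by (auto simp: ereal_L1_def)
  have "AE x in M. e2ennreal \<bar>g x\<bar> \<noteq> \<infinity>"
    using fin by (intro nn_integral_PInf_AE) auto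
  then show ae: "AE x in M. g x = ereal (real_of_ereal (g x))"
  proof eventually_elim
    case (elim x)
    then show ?case by (cases "g x") auto
  qed
  have "(\<integral>\<^sup>+x. ennreal (norm (real_of_ereal (g x))) \<partial>M) = (\<integral>\<^sup>+x. e2ennreal \<bar>g x\<bar> \<partial>M)"
  proof (rule nn_integral_cong_AE)
    show "AE x in M. ennreal (norm (real_of_ereal (g x))) = e2ennreal \<bar>g x\<bar>"
      using ae by eventually_elim (metis abs_ereal.simps(1) ennreal.abs_eq e2ennreal_ereal real_norm_def)
  qed
  then show int: "integrable M (\<lambda>x. real_of_ereal (g x))"
    using fin by (intro integrableI_bounded) auto
  have 1: "(\<integral>\<^sup>+x. e2ennreal (- g x) \<partial>M) = (\<integral>\<^sup>+x. ennreal (- real_of_ereal (g x)) \<partial>M)"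
    by (rule nn_integral_cong_AE, use ae in eventually_elim) (metis e2ennreal_ereal uminus_ereal.simps(1))
  have 2: "(\<integral>\<^sup>+x. e2ennreal (- (- g x)) \<partial>M) = (\<integral>\<^sup>+x. ennreal (real_of_ereal (g x)) \<partial>M)"
    by (rule nn_integral_cong_AE, use ae in eventually_elim) (metis e2ennreal_ereal ereal_uminus_uminus)
  have fin': "(\<integral>\<^sup>+x. ennreal (- real_of_ereal (g x)) \<partial>M) \<noteq> \<infinity>" "(\<integral>\<^sup>+x. ennreal (real_of_ereal (g x)) \<partial>M) \<noteq> \<infinity>"
    using int by (auto simp: real_integrable_def)
  then show "ereal_integral M (\<lambda>x. - g x) = ereal (- (\<integral>x. real_of_ereal (g x) \<partial>M))"
    unfolding ereal_integral_def 1 2 real_lebesgue_integral_def[OF int]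
    by (cases "\<integral>\<^sup>+x. ennreal (- real_of_ereal (g x)) \<partial>M"; cases "\<integral>\<^sup>+x. ennreal (real_of_ereal (g x)) \<partial>M") auto
qed

lemma closed_measure_support: "closed (measure_support M)"
proof -
  have "- measure_support M = \<Union>{U. open U \<and> emeasure M U = 0}"
    by (auto simp: measure_support_def zero_less_iff_neq_zero)
  then have "open (- measure_support M)" by (simp only: open_Union) (auto intro: open_Union)
  then show ?thesis by (simp add: closed_def)
qed

lemma measurable_exp_ereal[measurable]: "exp_ereal \<in> borel_measurable borel"
proof -
  have eq: "exp_ereal = (\<lambda>a. if a = \<infinity> then \<top> else if a = -\<infinity> then 0 else ennreal (exp (real_of_ereal a)))"
  proof
    show "exp_ereal a = (if a = \<infinity> then \<top> else if a = -\<infinity> then 0 else ennreal (exp (real_of_ereal a)))" for a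
      by (cases a) (auto simp: exp_ereal_def)
  qed
  show ?thesis unfolding eq by measurable
qed

context coercive_conjugate
begin

definition moment_measure :: "'a measure" where "moment_measure = distr gibbs borel maximizer"

lemma sets_moment_measure[simp, measurable_cong]: "sets moment_measure = sets borel" and space_moment_measure[simp]: "space moment_measure = UNIV"
  by (simp_all add: moment_measure_def)

lemma prob_space_moment_measure: "prob_space moment_measure"
proof -
  interpret prob_space gibbs by (rule prob_space_gibbs)
  show ?thesis unfolding moment_measure_def by (rule prob_space_distr) measurable
qed

lemma integrable_moment_measure_norm: "integrable moment_measure norm"
proof -
  interpret prob_space gibbs by (rule prob_space_gibbs)
  have "integrable gibbs (\<lambda>y. norm (maximizer y))"
    by (rule integrable_const_bound[where B="real DIM('a) * k"]) (use norm_maximizer_le in auto)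
  then show ?thesis unfolding moment_measure_def by (subst integrable_distr_eq) auto
qed

lemma compact_support_moment_measure: "compact (measure_support moment_measure)"
proof -
  let ?R = "real DIM('a) * k"
  have "x \<in> cball 0 ?R" if x: "x \<in> measure_support moment_measure" for x
  proof (rule ccontr)
    assume "x \<notin> cball 0 ?R"
    then have "0 < emeasure moment_measure (- cball 0 ?R)"
      using x by (auto simp: measure_support_def open_Compl)
    also have "emeasure moment_measure (- cball 0 ?R) = emeasure gibbs (maximizer -` (- cball 0 ?R) \<inter> space gibbs)"
      unfolding moment_measure_def by (rule emeasure_distr) auto
    also have "maximizer -` (- cball 0 ?R) \<inter> space gibbs = {}" using norm_maximizer_le by auto
    finally show False by simp
  qed
  then have "bounded (measure_support moment_measure)" by (meson bounded_cball bounded_subset subsetI)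
  then show ?thesis by (simp add: compact_eq_bounded_closed closed_measure_support)
qed

text \<open>The reflection \<open>\<sigma>\<close> preserves \<open>\<phi>\<close>, hence the Gibbs measure, and it maps the maximizers at \<open>y\<close> to the maximizers
  at \<open>\<sigma> y\<close>. Where they are unique, this says that \<open>\<sigma>\<close> commutes with \<open>maximizer\<close>.\<close>

lemma distr_moment_measure_reflection:
  fixes c :: "'a \<Rightarrow> real"
  defines "\<sigma> x \<equiv> \<Sum>b\<in>Basis. (c b * (x \<bullet> b)) *\<^sub>R b"
  assumes c: "\<And>b. b \<in> Basis \<Longrightarrow> \<bar>c b\<bar> = 1"
    and S: "\<And>x. x \<in> S \<Longrightarrow> \<sigma> x \<in> S" and F: "\<And>x. x \<in> S \<Longrightarrow> F (\<sigma> x) = F x"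
  shows "distr moment_measure borel \<sigma> = moment_measure"
proof -
  have [measurable]: "\<sigma> \<in> borel_measurable borel" unfolding \<sigma>_def by measurable
  have nth: "\<sigma> x \<bullet> b = c b * (x \<bullet> b)" if "b \<in> Basis" for x b
    using that unfolding \<sigma>_def
    by (simp add: inner_sum_left inner_Basis if_distrib if_distribR sum.delta cong: if_cong)
  have cc: "c b * c b = 1" if "b \<in> Basis" for b
    using c[OF that] by (metis abs_mult_self_eq mult_1)
  have inv: "\<sigma> (\<sigma> x) = x" for x
    by (rule euclidean_eqI) (simp add: nth cc mult.assoc[symmetric])
  have adj: "\<sigma> x \<bullet> y = x \<bullet> \<sigma> y" for x y
    by (subst (1 2) euclidean_inner) (auto intro!: sum.cong simp: nth)
  have phi_le: "\<phi> (\<sigma> y) \<le> \<phi> y" for y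
  proof -
    obtain x where x: "x \<in> S" "\<phi> (\<sigma> y) = x \<bullet> \<sigma> y - F x" using attained by blast
    show ?thesis using upper[OF S[OF x(1)], of y] x F[OF x(1)] adj[of x y] by simp
  qed
  have phi: "\<phi> (\<sigma> y) = \<phi> y" for y using phi_le[of y] phi_le[of "\<sigma> y"] by (simp add: inv)
  have "lborel = density (distr lborel borel \<sigma>) (\<lambda>_. (\<Prod>j\<in>Basis. \<bar>c j\<bar>))"
    using lborel_affine_euclidean[of c 0] c unfolding \<sigma>_def by fastforce
  then have lb: "distr lborel borel \<sigma> = lborel" using c by (simp add: density_1)
  have mu: "distr gibbs borel \<sigma> = gibbs"
  proof -
    have "gibbs = density (distr lborel borel \<sigma>) (\<lambda>y. ennreal (exp (- \<phi> y) / total_mass))"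
      by (simp add: lb gibbs_def)
    also have "\<dots> = distr (density lborel (\<lambda>y. ennreal (exp (- \<phi> (\<sigma> y)) / total_mass))) borel \<sigma>"
      by (rule density_distr) auto
    finally show ?thesis by (simp add: phi gibbs_def)
  qed
  have "AE y in distr lborel borel \<sigma>. \<forall>x\<in>S. \<phi> y = x \<bullet> y - F x \<longrightarrow> x = maximizer y"
    unfolding lb by (rule AE_unique_maximizer)
  then have "AE y in lborel. \<forall>x\<in>S. \<phi> (\<sigma> y) = x \<bullet> \<sigma> y - F x \<longrightarrow> x = maximizer (\<sigma> y)"
    by (rule AE_distrD[rotated]) measurable
  with AE_maximizer have "AE y in lborel. \<sigma> (maximizer y) = maximizer (\<sigma> y)"
  proof eventually_elim
    case (elim y)
    have "\<sigma> (maximizer y) \<bullet> \<sigma> y = maximizer y \<bullet> y" by (simp add: adj inv)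
    with elim show ?case by (auto simp: phi S F)
  qed
  then have ae: "AE y in gibbs. \<sigma> (maximizer y) = maximizer (\<sigma> y)" by (simp add: AE_gibbs_iff)
  have "distr moment_measure borel \<sigma> = distr gibbs borel (\<lambda>y. \<sigma> (maximizer y))"
    unfolding moment_measure_def by (subst distr_distr) (auto simp: comp_def)
  also have "\<dots> = distr gibbs borel (\<lambda>y. maximizer (\<sigma> y))" by (rule distr_cong_AE) (use ae in auto)
  also have "\<dots> = distr (distr gibbs borel \<sigma>) borel maximizer" by (subst distr_distr) (auto simp: comp_def)
  finally show ?thesis by (simp add: mu moment_measure_def)
qed

text \<open>For the conjugate \<open>\<psi>\<close> of \<open>g\<close> this is the tangent inequality \<open>L(g) \<ge> L(f) - \<integral>(g - f) d\<nu>\<close>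
  after exponentiation, where \<open>f\<close> extends \<open>F\<close> by \<open>\<infinity>\<close> outside \<open>S\<close> and \<open>\<nu>\<close> is the moment measure. If the integral of \<open>e\<^bsup>-\<psi>\<^esup>\<close> is restricted to a ball, then
  \<open>g\<close> may be cut off at a suitable constant along the maximizers, which bounds the exponent of
  \<open>integral_le_exp_integral\<close> from above; the result does not depend on the radius of the ball.\<close>

lemma exp_conjugate_integral_le:
  fixes g \<psi> :: "'a \<Rightarrow> ereal"
  assumes g: "g \<in> ereal_L1 moment_measure" and x0: "g x0 \<noteq> \<infinity>" and g_proper: "\<And>x. g x \<noteq> -\<infinity>"
    and \<psi>[measurable]: "\<psi> \<in> borel_measurable borel" and conj: "\<And>x b. ereal (x \<bullet> b) - g x \<le> \<psi> b"
  shows "(\<integral>\<^sup>+b. exp_ereal (- \<psi> b) \<partial>lborel)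
    \<le> ennreal (total_mass * exp ((\<integral>x. real_of_ereal (g x) \<partial>moment_measure) - (\<integral>y. F_maximizer y \<partial>gibbs)))"
proof -
  interpret prob_space gibbs by (rule prob_space_gibbs)
  define gX where "gX y = real_of_ereal (g (maximizer y))" for y
  have [measurable]: "g \<in> borel_measurable borel"
    using g by (simp add: ereal_L1_def cong: measurable_cong_sets)
  have gX: "integrable gibbs gX" "(\<integral>y. gX y \<partial>gibbs) = (\<integral>x. real_of_ereal (g x) \<partial>moment_measure)"
    using ereal_L1_integrable[OF g] unfolding moment_measure_def gX_def
    by (simp_all add: integrable_distr_eq integral_distr)
  have "AE y in gibbs. g (maximizer y) = ereal (gX y)"
    using ereal_L1_AE_finite[OF g] unfolding moment_measure_def gX_def
    by (rule AE_distrD[rotated]) measurable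
  then have fin: "AE y in lborel. g (maximizer y) = ereal (gX y)"
    by (simp add: AE_gibbs_iff)
  obtain r0 where r0: "g x0 = ereal r0" using x0 g_proper[of x0] by (cases "g x0") auto
  have exp_m: "(\<lambda>b. exp_ereal (- \<psi> b)) \<in> borel_measurable borel"
    by measurable
  note exp_m[measurable]
  have bound: "(\<integral>\<^sup>+b. exp_ereal (- \<psi> b) * indicator (cball 0 (real m)) b \<partial>lborel)
      \<le> ennreal (total_mass * exp ((\<integral>x. real_of_ereal (g x) \<partial>moment_measure) - (\<integral>y. F_maximizer y \<partial>gibbs)))" for m :: nat
  proof -
    define c where "c = real m * norm x0 + r0"
    have psi_lower: "ereal (- c) \<le> \<psi> b" if "norm b \<le> real m" for b
    proof -
      have "\<bar>x0 \<bullet> b\<bar> \<le> norm x0 * norm b" by (rule Cauchy_Schwarz_ineq2)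
      also have "\<dots> \<le> norm x0 * real m" using that by (intro mult_left_mono) auto
      finally have "ereal (- c) \<le> ereal (x0 \<bullet> b) - g x0" by (simp add: r0 c_def mult.commute)
      also have "\<dots> \<le> \<psi> b" by (rule conj)
      finally show ?thesis .
    qed
    define v where "v b = (if norm b \<le> real m then enn2real (exp_ereal (- \<psi> b)) else 0)" for b
    have v: "ennreal (v b) = exp_ereal (- \<psi> b) * indicator (cball 0 (real m)) b
      \<and> (v b = 0 \<or> (norm b \<le> real m \<and> (\<exists>r. \<psi> b = ereal r \<and> - c \<le> r \<and> v b = exp (- r))))" for b
    proof (cases "norm b \<le> real m")
      case True
      have "ereal (- c) \<le> \<psi> b" by (rule psi_lower[OF True])
      then show ?thesis using True by (cases "\<psi> b") (auto simp: v_def exp_ereal_def)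
    next
      case False
      then show ?thesis by (simp add: v_def)
    qed
    have v_bounds: "0 \<le> v b" "v b \<le> exp c" "v b \<noteq> 0 \<Longrightarrow> b \<in> cball 0 (real m)" for b
      using v[of b] by auto
    have [measurable]: "v \<in> borel_measurable borel" unfolding v_def by measurable
    have v_int: "integrable lborel v"
      by (rule integrable_bounded_support[where A="cball 0 (real m)" and B="exp c"])
        (use v_bounds emeasure_lborel_cball_finite[of "0::'a" "real m"] in auto)
    \<comment> \<open>For \<open>norm b \<le> m\<close> this bounds \<open>maximizer y \<bullet> b - \<psi> b\<close>, so replacing \<open>g\<close> by its minimum with \<open>C\<close>
      keeps the pointwise inequality that \<open>integral_le_exp_integral\<close> needs.\<close>
    define C where "C = real DIM('a) * k * real m + c"
    define D where "D y = min (gX y) C - F_maximizer y" for y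
    have D_int: "integrable gibbs D" unfolding D_def using gX(1) integrable_F_maximizer by auto
    have "(\<integral>b. v b \<partial>lborel) \<le> total_mass * exp (\<integral>y. D y \<partial>gibbs)"
    proof (rule integral_le_exp_integral[OF v_int _ D_int])
      show "AE y in gibbs. D y \<le> C + \<phi> 0"
        using AE_F_maximizer unfolding AE_gibbs_iff
      proof eventually_elim
        case (elim y)
        then show ?case using F_lower[of "maximizer y"] by (auto simp: D_def)
      qed
      show "AE y in lborel. \<forall>b. v b \<le> exp (D y + F_maximizer y - maximizer y \<bullet> b)"
        using fin
      proof eventually_elim
        case (elim y)
        show ?case
        proof
          fix b
          consider "v b = 0" | r where "norm b \<le> real m" "\<psi> b = ereal r" "- c \<le> r" "v b = exp (- r)"
            using v[of b] by blast
          then show "v b \<le> exp (D y + F_maximizer y - maximizer y \<bullet> b)"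
          proof cases
            case 2
            have "maximizer y \<bullet> b - gX y \<le> r" using conj[of "maximizer y" b] elim 2 by simp
            moreover have "maximizer y \<bullet> b \<le> norm (maximizer y) * norm b" by (rule norm_cauchy_schwarz)
            moreover have "\<dots> \<le> real DIM('a) * k * real m"
              using 2 norm_maximizer_le k_nonneg by (intro mult_mono) auto
            ultimately show ?thesis using 2 by (auto simp: D_def C_def min_def)
          qed simp
        qed
      qed
    qed (rule v_bounds)
    also have "(\<integral>y. D y \<partial>gibbs) \<le> (\<integral>y. gX y - F_maximizer y \<partial>gibbs)"
      using gX(1) integrable_F_maximizer D_int by (intro integral_mono) (auto simp: D_def)
    then have "total_mass * exp (\<integral>y. D y \<partial>gibbs) \<le> total_mass * exp ((\<integral>x. real_of_ereal (g x) \<partial>moment_measure) - (\<integral>y. F_maximizer y \<partial>gibbs))"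
      using total_mass_pos gX integrable_F_maximizer by simp
    finally have "(\<integral>b. v b \<partial>lborel) \<le> total_mass * exp ((\<integral>x. real_of_ereal (g x) \<partial>moment_measure) - (\<integral>y. F_maximizer y \<partial>gibbs))" .
    moreover have "(\<integral>\<^sup>+b. exp_ereal (- \<psi> b) * indicator (cball 0 (real m)) b \<partial>lborel) = ennreal (\<integral>b. v b \<partial>lborel)"
      unfolding conjunct1[OF v, symmetric] using v_bounds by (intro nn_integral_eq_integral[OF v_int]) auto
    ultimately show ?thesis by (simp add: ennreal_leI)
  qed
  have "(\<integral>\<^sup>+b. exp_ereal (- \<psi> b) \<partial>lborel)
      = (\<integral>\<^sup>+b. (SUP m. exp_ereal (- \<psi> b) * indicator (cball 0 (real m)) b) \<partial>lborel)"
  proof (rule nn_integral_cong)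
    fix b :: 'a
    obtain m where "norm b \<le> real m" using real_arch_simple by blast
    then show "exp_ereal (- \<psi> b) = (SUP m. exp_ereal (- \<psi> b) * indicator (cball 0 (real m)) b)"
      by (intro antisym SUP_upper2[of m] SUP_least) (auto simp: indicator_def)
  qed
  also have "\<dots> = (SUP m. \<integral>\<^sup>+b. exp_ereal (- \<psi> b) * indicator (cball 0 (real m)) b \<partial>lborel)"
    by (rule nn_integral_monotone_convergence_SUP) (auto simp: incseq_def le_fun_def indicator_def)
  also have "\<dots> \<le> ennreal (total_mass * exp ((\<integral>x. real_of_ereal (g x) \<partial>moment_measure) - (\<integral>y. F_maximizer y \<partial>gibbs)))"
    by (rule SUP_least) (rule bound)
  finally show ?thesis .
qed

end

section \<open>Lower semicontinuous convex functions\<close>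

lemma lower_semicontinuous_open_above:
  assumes "lower_semicontinuous f"
  shows "open {x. d < f x}"
proof (subst open_subopen, intro ballI)
  fix x assume "x \<in> {x. d < f x}"
  then have "d < f x" by simp
  also have "f x \<le> Liminf (at x) f" using assms by (simp add: lower_semicontinuous_def)
  finally have "eventually (\<lambda>z. d < f z) (at x)" by (rule less_LiminfD)
  with \<open>d < f x\<close> have "eventually (\<lambda>z. d < f z) (nhds x)"
    by (auto simp: eventually_at_filter elim: eventually_mono)
  then show "\<exists>T. open T \<and> x \<in> T \<and> T \<subseteq> {x. d < f x}"
    unfolding eventually_nhds by blast
qed

lemma lower_semicontinuous_borel_measurable:
  assumes "lower_semicontinuous f"
  shows "f \<in> borel_measurable borel"
  using lower_semicontinuous_open_above[OF assms] by (intro borel_measurableI_greater) auto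

lemma lower_semicontinuous_open_above_continuous:
  fixes a :: "'a::topological_space \<Rightarrow> real"
  assumes f: "lower_semicontinuous f" and a: "continuous_on UNIV a"
  shows "open {x. ereal (a x) < f x}"
proof -
  have "{x. ereal (a x) < f x} = (\<Union>d. {x. a x < d} \<inter> {x. ereal d < f x})"
  proof (intro set_eqI iffI)
    fix x assume "x \<in> {x. ereal (a x) < f x}"
    then obtain d where "ereal (a x) < ereal d" "ereal d < f x" using ereal_dense2[of "ereal (a x)" "f x"] by auto
    then show "x \<in> (\<Union>d. {x. a x < d} \<inter> {x. ereal d < f x})" by auto
  next
    fix x assume "x \<in> (\<Union>d. {x. a x < d} \<inter> {x. ereal d < f x})"
    then obtain d where "ereal (a x) < ereal d" "ereal d < f x" by auto
    then show "x \<in> {x. ereal (a x) < f x}" using less_trans by blast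
  qed
  moreover have "open {x. a x < d}" for d by (rule open_Collect_less[OF a]) (rule continuous_on_const)
  ultimately show ?thesis
    using lower_semicontinuous_open_above[OF f] by (simp add: open_UN open_Int)
qed

text \<open>If no minimum were attained, the open sets \<open>{x. G z < G x}\<close> with \<open>z \<in> K\<close> would cover \<open>K\<close>. Among the
  finitely many \<open>z\<close> of a subcover, one that minimizes \<open>G\<close> is not covered.\<close>

lemma compact_attains_min:
  fixes G :: "'a::topological_space \<Rightarrow> 'b::linorder"
  assumes "compact K" "K \<noteq> {}" and op: "\<And>z. z \<in> K \<Longrightarrow> open {x. G z < G x}"
  shows "\<exists>x\<in>K. \<forall>z\<in>K. G x \<le> G z"
proof (rule ccontr)
  assume "\<not> ?thesis"
  then have "K \<subseteq> (\<Union>z\<in>K. {x. G z < G x})" by (force simp: not_le)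
  then obtain C where C: "C \<subseteq> K" "finite C" "K \<subseteq> (\<Union>z\<in>C. {x. G z < G x})"
    using compactE_image[OF assms(1), of K "\<lambda>z. {x. G z < G x}"] op by metis
  have "C \<noteq> {}" using C assms(2) by auto
  then obtain z where z: "z \<in> C" "\<forall>y\<in>C. G z \<le> G y"
    using C(2) by (metis arg_min_if_finite(1) arg_min_least)
  then show False using C(1,3) by (force simp: not_le[symmetric])
qed

lemma convex_zero_notin_interior_halfspace:
  fixes C :: "'a::euclidean_space set"
  assumes C: "convex C" and 0: "0 \<notin> interior C"
  shows "\<exists>u. u \<noteq> 0 \<and> (\<forall>x\<in>C. x \<bullet> u \<le> 0)"
proof (cases "interior C = {}")
  case True
  then obtain a b where ab: "a \<noteq> 0" "C \<subseteq> {x. a \<bullet> x = b}"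
    using empty_interior_subset_hyperplane[OF C] by metis
  show ?thesis
  proof (cases "b \<le> 0")
    case True
    then show ?thesis using ab by (intro exI[of _ a]) (auto simp: inner_commute)
  next
    case False
    then show ?thesis using ab by (intro exI[of _ "- a"]) (auto simp: inner_commute)
  qed
next
  case False
  obtain a where a: "a \<noteq> 0" "\<forall>x\<in>interior C. 0 \<le> a \<bullet> x"
    using separating_hyperplane_set_0[OF convex_interior[OF C] 0] by blast
  have "closure (interior C) \<subseteq> {x. 0 \<le> a \<bullet> x}"
    using a(2) by (intro closure_minimal closed_halfspace_ge) auto
  then have "\<forall>x\<in>C. 0 \<le> a \<bullet> x"
    using convex_closure_interior[OF C False] closure_subset by blast
  then show ?thesis using a(1) by (intro exI[of _ "- a"]) (auto simp: inner_commute)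
qed

lemma nn_integral_lborel_translate:
  fixes w :: "'a::euclidean_space \<Rightarrow> ennreal"
  assumes [measurable]: "w \<in> borel_measurable borel"
  shows "(\<integral>\<^sup>+x. w (x + c) \<partial>lborel) = (\<integral>\<^sup>+x. w x \<partial>lborel)"
proof -
  have "(\<integral>\<^sup>+x. w x \<partial>lborel) = (\<integral>\<^sup>+x. w x \<partial>distr lborel borel ((+) c))" by (simp add: lborel_distr_plus)
  also have "\<dots> = (\<integral>\<^sup>+x. w (c + x) \<partial>lborel)" by (rule nn_integral_distr) auto
  finally show ?thesis by (simp add: add.commute)
qed

text \<open>The mass of the half-space \<open>{x. s < x \<bullet> u}\<close> does not decrease when its boundary is translated by \<open>u\<close>, because \<open>w\<close>
  does not decrease along \<open>u\<close>. But it tends to \<open>0\<close> as the half-space recedes, so every half-space has mass \<open>0\<close>.\<close>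

lemma nn_integral_eq_0_of_mono_direction:
  fixes w :: "'a::euclidean_space \<Rightarrow> ennreal"
  assumes [measurable]: "w \<in> borel_measurable borel" and fin: "(\<integral>\<^sup>+x. w x \<partial>lborel) < \<infinity>"
    and u: "u \<noteq> 0" and mono: "\<And>x. w x \<le> w (x + u)"
  shows "(\<integral>\<^sup>+x. w x \<partial>lborel) = 0"
proof -
  define c where "c = u \<bullet> u"
  have c: "0 < c" using u by (simp add: c_def)
  define G where "G s = (\<integral>\<^sup>+x. w x * indicator {x. s < x \<bullet> u} x \<partial>lborel)" for s
  have step: "G s \<le> G (s + c)" for s
  proof -
    have "G s \<le> (\<integral>\<^sup>+x. w (x + u) * indicator {x. s + c < x \<bullet> u} (x + u) \<partial>lborel)"
      unfolding G_def using mono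
      by (intro nn_integral_mono mult_mono) (auto simp: indicator_def c_def inner_add_left)
    also have "\<dots> = G (s + c)"
      unfolding G_def by (rule nn_integral_lborel_translate[of "\<lambda>x. w x * indicator {x. s + c < x \<bullet> u} x"]) measurable
    finally show ?thesis .
  qed
  have le: "G s \<le> G (s + real m * c)" for s m
  proof (induction m)
    case (Suc m)
    then show ?case using step[of "s + real m * c"] by (auto simp: algebra_simps)
  qed simp
  have lim: "(\<lambda>m. G (s m)) \<longlonglongrightarrow> (\<integral>\<^sup>+x. w x * indicator A x \<partial>lborel)"
    if [measurable]: "A \<in> sets borel" and A: "\<And>x. eventually (\<lambda>m. s m < x \<bullet> u \<longleftrightarrow> x \<in> A) sequentially" for s :: "nat \<Rightarrow> real" and A
    unfolding G_def
  proof (rule nn_integral_dominated_convergence[where w=w])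
    show "AE x in lborel. (\<lambda>m. w x * indicator {x. s m < x \<bullet> u} x) \<longlonglongrightarrow> w x * indicator A x"
    proof (intro AE_I2 tendsto_eventually)
      fix x show "eventually (\<lambda>m. w x * indicator {x. s m < x \<bullet> u} x = w x * indicator A x) sequentially"
        using A[of x] by eventually_elim (simp add: indicator_def)
    qed
  qed (use fin in \<open>auto simp: indicator_def\<close>)
  have G0: "G s = 0" for s
  proof -
    have "(\<lambda>m. G (s + real m * c)) \<longlonglongrightarrow> (\<integral>\<^sup>+x. w x * indicator {} x \<partial>lborel)"
    proof (rule lim)
      fix x
      have "filterlim (\<lambda>m. s + real m * c) at_top sequentially" using c by real_asymp
      then show "eventually (\<lambda>m. s + real m * c < x \<bullet> u \<longleftrightarrow> x \<in> {}) sequentially"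
        by (auto simp: filterlim_at_top not_less)
    qed simp
    then show "G s = 0" using LIMSEQ_le_const[of "\<lambda>m. G (s + real m * c)" 0 "G s"] le by auto
  qed
  have "(\<lambda>m. G (- real m)) \<longlonglongrightarrow> (\<integral>\<^sup>+x. w x * indicator UNIV x \<partial>lborel)"
  proof (rule lim)
    fix x
    have "filterlim (\<lambda>m. - real m) at_bot sequentially" by real_asymp
    then show "eventually (\<lambda>m. - real m < x \<bullet> u \<longleftrightarrow> x \<in> UNIV) sequentially"
      by (auto simp: filterlim_at_bot_dense)
  qed simp
  then show ?thesis using LIMSEQ_unique[of "\<lambda>m. G (- real m)" _ 0] by (simp add: G0)
qed

lemma exp_ereal_mono: "a \<le> b \<Longrightarrow> exp_ereal a \<le> exp_ereal b"
  by (cases a; cases b) (auto simp: exp_ereal_def)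

lemma conjugate_measurable[measurable]: "conjugate f \<in> borel_measurable borel"
proof (rule borel_measurableI_greater)
  fix c
  have "open {y. c < ereal (x \<bullet> y) - f x}" for x
  proof (cases "f x")
    case (real r)
    have "{y. c < ereal (x \<bullet> y) - f x} = {y. c < ereal (x \<bullet> y - r)}" by (simp add: real)
    then show ?thesis by (auto intro!: open_Collect_less continuous_intros)
  qed auto
  moreover have "{y. c < conjugate f y} = (\<Union>x. {y. c < ereal (x \<bullet> y) - f x})"
    by (auto simp: conjugate_def less_SUP_iff)
  ultimately have "open {y. c < conjugate f y}" by auto
  then show "{y \<in> space borel. c < conjugate f y} \<in> sets borel" by simp
qed

lemma conjugate_upper: "ereal (x \<bullet> y) - f x \<le> conjugate f y"
  unfolding conjugate_def by (rule SUP_upper) simp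

text \<open>Otherwise the domain lies in a half-space \<open>{x. x \<bullet> u \<le> 0}\<close>. Then \<open>f\<^sup>*\<close> does not increase along \<open>u\<close>, and
  the integral of \<open>e\<^bsup>-f\<^sup>*\<^esup>\<close> could only be \<open>0\<close> or \<open>\<infinity>\<close>.\<close>

lemma zero_in_interior_domain:
  assumes f: "f \<in> convex_lsc_funs" and pos: "exp_conj_integral f > 0" and fin: "exp_conj_integral f < \<infinity>"
  shows "0 \<in> interior {x. f x \<noteq> \<infinity>}"
proof (rule ccontr)
  assume n: "0 \<notin> interior {x. f x \<noteq> \<infinity>}"
  have "convex {x. f x \<noteq> \<infinity>}"
  proof (rule convexI)
    fix x y and u v :: real assume *: "x \<in> {x. f x \<noteq> \<infinity>}" "y \<in> {x. f x \<noteq> \<infinity>}" "0 \<le> u" "0 \<le> v" "u + v = 1"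
    have "f (u *\<^sub>R x + v *\<^sub>R y) \<le> ereal u * f x + ereal v * f y"
      using f * by (auto simp: convex_lsc_funs_def ereal_convex_def)
    also have "\<dots> < \<infinity>" using * f by (cases "f x"; cases "f y") (auto simp: convex_lsc_funs_def)
    finally show "u *\<^sub>R x + v *\<^sub>R y \<in> {x. f x \<noteq> \<infinity>}" by auto
  qed
  from convex_zero_notin_interior_halfspace[OF this n] obtain u
    where u: "u \<noteq> 0" "\<And>x. f x \<noteq> \<infinity> \<Longrightarrow> x \<bullet> u \<le> 0" by auto
  have "conjugate f (y + u) \<le> conjugate f y" for y
    unfolding conjugate_def
  proof (rule SUP_mono)
    fix x show "\<exists>x'\<in>UNIV. ereal (x \<bullet> (y + u)) - f x \<le> ereal (x' \<bullet> y) - f x'"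
      using u(2)[of x] by (intro bexI[of _ x]) (cases "f x", auto simp: inner_add_right)
  qed
  then have "exp_ereal (- conjugate f y) \<le> exp_ereal (- conjugate f (y + u))" for y
    by (intro exp_ereal_mono) (simp only: ereal_minus_le_minus)
  then have "exp_conj_integral f = 0"
    unfolding exp_conj_integral_def
    by (intro nn_integral_eq_0_of_mono_direction[OF _ _ u(1)]) (use fin in \<open>auto simp: exp_conj_integral_def\<close>)
  then show False using pos by simp
qed

section \<open>Truncation of the conjugate to a ball\<close>

definition domain_in_ball :: "('a::euclidean_space \<Rightarrow> ereal) \<Rightarrow> real \<Rightarrow> 'a set" where
  "domain_in_ball f k = {x. norm x \<le> k \<and> f x \<noteq> \<infinity>}"

lemma domain_in_ball_mono: "k \<le> l \<Longrightarrow> domain_in_ball f k \<subseteq> domain_in_ball f l"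
  by (auto simp: domain_in_ball_def)

text \<open>The conjugate of the function that equals \<open>f\<close> on the ball of radius \<open>k\<close> and \<open>\<infinity>\<close> outside. The supremum is
  taken in the reals, over points where \<open>f\<close> is finite.\<close>

definition ball_conjugate :: "('a::euclidean_space \<Rightarrow> ereal) \<Rightarrow> real \<Rightarrow> 'a \<Rightarrow> real" where
  "ball_conjugate f k y = (SUP x\<in>domain_in_ball f k. x \<bullet> y - real_of_ereal (f x))"

lemma ball_conjugate_attained:
  assumes lsc: "lower_semicontinuous f" and proper: "\<And>x. f x \<noteq> -\<infinity>"
    and ne: "domain_in_ball f k \<noteq> {}"
  shows "\<exists>x\<in>domain_in_ball f k. ball_conjugate f k y = x \<bullet> y - real_of_ereal (f x)"
    and "x \<in> domain_in_ball f k \<Longrightarrow> x \<bullet> y - real_of_ereal (f x) \<le> ball_conjugate f k y"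
proof -
  obtain x0 where x0: "x0 \<in> domain_in_ball f k" using ne by blast
  define G where "G x = f x - ereal (x \<bullet> y)" for x
  have "\<exists>x\<in>cball 0 k. \<forall>z\<in>cball 0 k. G x \<le> G z"
  proof (rule compact_attains_min)
    have "x0 \<in> cball 0 k" using x0 by (simp add: domain_in_ball_def)
    then show "cball (0::'a) k \<noteq> {}" by blast
    fix z
    show "open {x. G z < G x}"
    proof (cases "f z")
      case (real r)
      have "{x. G z < G x} = {x. ereal (r - z \<bullet> y + x \<bullet> y) < f x}"
      proof (intro Collect_cong)
        fix x show "G z < G x \<longleftrightarrow> ereal (r - z \<bullet> y + x \<bullet> y) < f x"
          by (cases "f x") (auto simp: G_def real)
      qed
      then show ?thesis
        using lower_semicontinuous_open_above_continuous[OF lsc, of "\<lambda>x. r - z \<bullet> y + x \<bullet> y"]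
        by (simp add: continuous_intros)
    next
      case PInf
      then show ?thesis by (simp add: G_def)
    qed (use proper in simp)
  qed simp
  then obtain x where x: "x \<in> cball 0 k" and min: "\<And>z. z \<in> cball 0 k \<Longrightarrow> G x \<le> G z" by blast
  have "G x \<le> G x0" using x0 by (intro min) (auto simp: domain_in_ball_def)
  then have xS: "x \<in> domain_in_ball f k"
    using x x0 proper[of x0] by (cases "f x0") (auto simp: domain_in_ball_def G_def)
  have le: "z \<bullet> y - real_of_ereal (f z) \<le> x \<bullet> y - real_of_ereal (f x)" if z: "z \<in> domain_in_ball f k" for z
  proof -
    have "G x \<le> G z" using z by (intro min) (auto simp: domain_in_ball_def)
    then show ?thesis
      using z xS proper[of x] proper[of z] by (cases "f x"; cases "f z") (auto simp: domain_in_ball_def G_def)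
  qed
  have eq: "ball_conjugate f k y = x \<bullet> y - real_of_ereal (f x)"
    unfolding ball_conjugate_def
    by (intro antisym cSUP_least cSUP_upper le ne xS bdd_aboveI2[where M="x \<bullet> y - real_of_ereal (f x)"])
  show "\<exists>x\<in>domain_in_ball f k. ball_conjugate f k y = x \<bullet> y - real_of_ereal (f x)" using eq xS by blast
  show "x \<in> domain_in_ball f k \<Longrightarrow> x \<bullet> y - real_of_ereal (f x) \<le> ball_conjugate f k y" for x
    using le by (simp add: eq)
qed

lemma ball_conjugate_mono:
  assumes lsc: "lower_semicontinuous f" and proper: "\<And>x. f x \<noteq> -\<infinity>"
    and ne: "domain_in_ball f k \<noteq> {}" and "k \<le> l"
  shows "ball_conjugate f k y \<le> ball_conjugate f l y"
proof -
  obtain x where x: "x \<in> domain_in_ball f k" "ball_conjugate f k y = x \<bullet> y - real_of_ereal (f x)"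
    using ball_conjugate_attained(1)[OF lsc proper ne] by blast
  then have "x \<in> domain_in_ball f l" using \<open>k \<le> l\<close> by (auto simp: domain_in_ball_def)
  then show ?thesis using ball_conjugate_attained(2)[OF lsc proper] x(2) by fastforce
qed

text \<open>Linear growth comes from the finitely many points \<open>\<plusminus>r e\<close> with \<open>e\<close> a basis vector, at which \<open>f\<close> is finite:
  they give \<open>\<phi> y \<ge> r \<bar>y \<bullet> e\<bar> - B\<close> for each \<open>e\<close>, and the average over \<open>e\<close> is the required bound.\<close>

lemma coercive_conjugate_ball_conjugate:
  fixes f :: "'a::euclidean_space \<Rightarrow> ereal"
  assumes lsc: "lower_semicontinuous f" and proper: "\<And>x. f x \<noteq> -\<infinity>"
    and r: "0 < r" "cball 0 r \<subseteq> {x. f x \<noteq> \<infinity>}" and k: "r \<le> k"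
  shows "\<exists>a b. coercive_conjugate (domain_in_ball f k) (\<lambda>x. real_of_ereal (f x)) (ball_conjugate f k) k a b"
proof -
  let ?F = "\<lambda>x. real_of_ereal (f x)"
  define B where "B = (\<Sum>i\<in>(Basis::'a set). \<bar>?F (r *\<^sub>R i)\<bar> + \<bar>?F (- r *\<^sub>R i)\<bar>)"
  have S: "x \<in> domain_in_ball f k" if "norm x \<le> r" for x
    using that r k by (auto simp: domain_in_ball_def subset_eq)
  have ne: "domain_in_ball f k \<noteq> {}" using S[of 0] r by auto
  note att = ball_conjugate_attained[OF lsc proper ne]
  have "r / real DIM('a) * (\<Sum>i\<in>Basis. \<bar>y \<bullet> i\<bar>) - B \<le> ball_conjugate f k y" for y
  proof -
    have "r * \<bar>y \<bullet> i\<bar> - B \<le> ball_conjugate f k y" if i: "i \<in> Basis" for i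
    proof -
      have B: "\<bar>?F (r *\<^sub>R i)\<bar> + \<bar>?F (- r *\<^sub>R i)\<bar> \<le> B"
        unfolding B_def by (rule member_le_sum[OF i]) (intro add_nonneg_nonneg abs_ge_zero, simp)
      have "r * (i \<bullet> y) - ?F (r *\<^sub>R i) \<le> ball_conjugate f k y"
        using att(2)[OF S[of "r *\<^sub>R i"], of y] i r by simp
      moreover have "- r * (i \<bullet> y) - ?F (- r *\<^sub>R i) \<le> ball_conjugate f k y"
        using att(2)[OF S[of "- r *\<^sub>R i"], of y] i r by simp
      moreover have "r * \<bar>y \<bullet> i\<bar> = r * (i \<bullet> y) \<or> r * \<bar>y \<bullet> i\<bar> = - r * (i \<bullet> y)"
        by (auto simp: inner_commute abs_if)
      ultimately show ?thesis
        using B abs_ge_self[of "?F (r *\<^sub>R i)"] abs_ge_self[of "?F (- r *\<^sub>R i)"]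
          abs_ge_zero[of "?F (r *\<^sub>R i)"] abs_ge_zero[of "?F (- r *\<^sub>R i)"] by linarith
    qed
    then have "(\<Sum>i\<in>(Basis::'a set). r * \<bar>y \<bullet> i\<bar> - B) \<le> (\<Sum>i\<in>(Basis::'a set). ball_conjugate f k y)"
      by (rule sum_mono)
    then have "r * (\<Sum>i\<in>Basis. \<bar>y \<bullet> i\<bar>) - real DIM('a) * B \<le> real DIM('a) * ball_conjugate f k y"
      by (simp add: sum_subtractf sum_distrib_left)
    then show ?thesis by (simp add: field_simps)
  qed
  then have "coercive_conjugate (domain_in_ball f k) ?F (ball_conjugate f k) k (r / real DIM('a)) B"
    using att r by unfold_locales (auto simp: domain_in_ball_def)
  then show ?thesis by blast
qed

lemma ball_conjugate_tendsto_conjugate: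
  fixes f :: "real ^ 'n \<Rightarrow> ereal"
  assumes lsc: "lower_semicontinuous f" and proper: "\<And>x. f x \<noteq> -\<infinity>"
    and ne: "domain_in_ball f k0 \<noteq> {}"
  shows "(\<lambda>m. ereal (ball_conjugate f (k0 + real m) y)) \<longlonglongrightarrow> conjugate f y"
proof (rule order_tendstoI)
  have ne': "domain_in_ball f (k0 + real m) \<noteq> {}" for m using ne domain_in_ball_mono[of k0 "k0 + real m" f] by auto
  note att = ball_conjugate_attained[OF lsc proper ne']
  fix l assume "l < conjugate f y"
  then obtain x where x: "l < ereal (x \<bullet> y) - f x" by (auto simp: conjugate_def less_SUP_iff)
  obtain N where N: "norm x - k0 \<le> real N" using real_arch_simple by blast
  have "l < ereal (ball_conjugate f (k0 + real m) y)" if "N \<le> m" for m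
  proof -
    have "x \<in> domain_in_ball f (k0 + real m)" using x N that by (auto simp: domain_in_ball_def)
    from att(2)[OF this, of y] have "ereal (x \<bullet> y) - f x \<le> ereal (ball_conjugate f (k0 + real m) y)"
      using x proper[of x] by (cases "f x") auto
    with x show ?thesis by (rule less_le_trans)
  qed
  then show "eventually (\<lambda>m. l < ereal (ball_conjugate f (k0 + real m) y)) sequentially"
    by (auto intro: eventually_sequentiallyI[of N])
next
  have ne': "domain_in_ball f (k0 + real m) \<noteq> {}" for m using ne domain_in_ball_mono[of k0 "k0 + real m" f] by auto
  note att = ball_conjugate_attained[OF lsc proper ne']
  fix l assume l: "conjugate f y < l"
  have "ereal (ball_conjugate f (k0 + real m) y) \<le> conjugate f y" for m
  proof -
    obtain x where x: "x \<in> domain_in_ball f (k0 + real m)" "ball_conjugate f (k0 + real m) y = x \<bullet> y - real_of_ereal (f x)"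
      using att(1) by blast
    then have "ereal (ball_conjugate f (k0 + real m) y) = ereal (x \<bullet> y) - f x"
      using proper[of x] by (cases "f x") (auto simp: domain_in_ball_def)
    then show ?thesis using conjugate_upper[of x y f] by simp
  qed
  then show "eventually (\<lambda>m. ereal (ball_conjugate f (k0 + real m) y) < l) sequentially"
    using l le_less_trans by (intro always_eventually) blast
qed

lemma exp_ereal_uminus_tendsto:
  assumes "(\<lambda>m. ereal (p m)) \<longlonglongrightarrow> c" and "c \<noteq> -\<infinity>"
  shows "(\<lambda>m. ennreal (exp (- p m))) \<longlonglongrightarrow> exp_ereal (- c)"
proof (cases c)
  case (real r)
  then have "p \<longlonglongrightarrow> r" using assms(1) by simp
  then show ?thesis using real by (auto simp: exp_ereal_def intro!: tendsto_intros tendsto_ennrealI)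
next
  case PInf
  then have "filterlim p at_top sequentially" using assms(1) by (simp add: tendsto_PInfty_eq_at_top)
  then have "(\<lambda>m. exp (- p m)) \<longlonglongrightarrow> 0"
    by (intro filterlim_compose[OF exp_at_bot]) (simp add: filterlim_uminus_at_bot)
  then have "(\<lambda>m. ennreal (exp (- p m))) \<longlonglongrightarrow> ennreal 0" by (rule tendsto_ennrealI)
  then show ?thesis using PInf by (simp add: exp_ereal_def)
qed (use assms in simp)

text \<open>The integrands decrease to \<open>e\<^bsup>-f\<^sup>*\<^esup>\<close> and the one for radius \<open>r\<close> is integrable, so that
  dominated convergence applies.\<close>

lemma truncated_integral_tendsto:
  fixes f :: "real ^ 'n \<Rightarrow> ereal"
  assumes f: "f \<in> convex_lsc_funs" and r: "0 < r" "cball 0 r \<subseteq> {x. f x \<noteq> \<infinity>}"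
  shows "(\<lambda>m. \<integral>\<^sup>+y. ennreal (exp (- ball_conjugate f (r + real m) y)) \<partial>lborel) \<longlonglongrightarrow> exp_conj_integral f"
  unfolding exp_conj_integral_def
proof (rule nn_integral_dominated_convergence)
  have lsc: "lower_semicontinuous f" and proper: "\<And>x. f x \<noteq> -\<infinity>" using f by (auto simp: convex_lsc_funs_def)
  have ne: "domain_in_ball f r \<noteq> {}" using r by (auto simp: domain_in_ball_def subset_eq intro!: exI[of _ 0])
  have cc: "\<exists>a b. coercive_conjugate (domain_in_ball f (r + real m)) (\<lambda>x. real_of_ereal (f x)) (ball_conjugate f (r + real m)) (r + real m) a b" for m
    using coercive_conjugate_ball_conjugate[OF lsc proper r, of "r + real m"] by simp
  have meas: "ball_conjugate f (r + real m) \<in> borel_measurable borel" for m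
    using cc coercive_conjugate.measurable_phi by blast
  note meas[measurable]
  have [measurable]: "ball_conjugate f r \<in> borel_measurable borel" using meas[of 0] by simp
  show "(\<lambda>y. ennreal (exp (- ball_conjugate f (r + real m) y))) \<in> borel_measurable lborel" for m by measurable
  show "(\<lambda>y. ennreal (exp (- ball_conjugate f r y))) \<in> borel_measurable lborel" by measurable
  show "(\<lambda>y. exp_ereal (- conjugate f y)) \<in> borel_measurable lborel" by measurable
  show "(\<integral>\<^sup>+y. ennreal (exp (- ball_conjugate f r y)) \<partial>lborel) < \<infinity>"
    using cc[of 0] coercive_conjugate.nn_integral_exp_phi by fastforce
  show "AE y in lborel. ennreal (exp (- ball_conjugate f (r + real m) y)) \<le> ennreal (exp (- ball_conjugate f r y))" for m
    using ball_conjugate_mono[OF lsc proper ne, of "r + real m"] by (intro AE_I2 ennreal_leI) simp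
  obtain x0 where "f x0 \<noteq> \<infinity>" using f by (auto simp: convex_lsc_funs_def)
  then have "conjugate f y \<noteq> -\<infinity>" for y
    using conjugate_upper[of x0 y f] proper[of x0] by (cases "f x0") auto
  then show "AE y in lborel. (\<lambda>m. ennreal (exp (- ball_conjugate f (r + real m) y))) \<longlonglongrightarrow> exp_ereal (- conjugate f y)"
    by (intro AE_I2 exp_ereal_uminus_tendsto ball_conjugate_tendsto_conjugate lsc proper ne)
qed

text \<open>The tangent inequality bounds all test functions at once. The right-hand side is the value at \<open>F\<close> itself,
  so \<open>F\<close> is an optimal test function for its moment measure.\<close>

lemma K_Leb_tangent_le:
  fixes S :: "(real ^ 'n) set"
  assumes "coercive_conjugate S F \<phi> k a b"
  shows "K_Leb (coercive_conjugate.moment_measure \<phi>)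
    \<le> ereal (ln (coercive_conjugate.total_mass \<phi>) - (\<integral>y. coercive_conjugate.F_maximizer \<phi> y \<partial>coercive_conjugate.gibbs \<phi>))"
proof -
  interpret coercive_conjugate S F \<phi> k a b by fact
  show ?thesis
    unfolding K_Leb_def
  proof (rule SUP_least)
    fix g :: "real ^ 'n \<Rightarrow> ereal" assume g: "g \<in> ereal_L1 moment_measure \<inter> convex_lsc_funs"
    let ?I = "exp_conj_integral g" and ?m = "\<integral>x. real_of_ereal (g x) \<partial>moment_measure" and ?n = "\<integral>y. F_maximizer y \<partial>gibbs"
    obtain x0 where "g x0 \<noteq> \<infinity>" using g by (auto simp: convex_lsc_funs_def)
    then have I: "?I \<le> ennreal (total_mass * exp (?m - ?n))"
      unfolding exp_conj_integral_def
      using g by (intro exp_conjugate_integral_le conjugate_upper) (auto simp: convex_lsc_funs_def)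
    have "ln_ennreal ?I \<le> ereal (ln total_mass + (?m - ?n))"
    proof (cases "?I = 0")
      case False
      then obtain i where i: "?I = ennreal i" "0 < i"
        using I by (cases "?I") (auto simp: top_unique)
      then have "i \<le> total_mass * exp (?m - ?n)" using I total_mass_pos by simp
      then have "ln i \<le> ln (total_mass * exp (?m - ?n))" using i by simp
      also have "\<dots> = ln total_mass + (?m - ?n)" using total_mass_pos by (simp add: ln_mult)
      finally show ?thesis using i by (simp add: ln_ennreal_def)
    qed (simp add: ln_ennreal_def)
    then show "ereal_integral moment_measure (\<lambda>x. - g x) - L_Leb g \<le> ereal (ln total_mass - ?n)"
      using g by (cases "ln_ennreal ?I") (auto simp: ereal_integral_uminus_L1 L_Leb_def)
  qed
qed

section \<open>Duality\<close>

lemma norm_in_convex_lsc_funs: "(\<lambda>x::real ^ 'n. ereal (norm x)) \<in> convex_lsc_funs"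
proof -
  have "Liminf (at x) (\<lambda>x. ereal (norm x)) = ereal (norm x)" for x :: "real ^ 'n"
    by (intro lim_imp_Liminf tendsto_intros) simp
  moreover have "ereal_convex (\<lambda>x::real ^ 'n. ereal (norm x))"
    unfolding ereal_convex_def
  proof (intro allI impI)
    fix x y :: "real ^ 'n" and u v :: real assume uv: "0 \<le> u" "0 \<le> v"
    have "norm (u *\<^sub>R x + v *\<^sub>R y) \<le> u * norm x + v * norm y"
      using norm_triangle_ineq[of "u *\<^sub>R x" "v *\<^sub>R y"] uv by simp
    then show "ereal (norm (u *\<^sub>R x + v *\<^sub>R y)) \<le> ereal u * ereal (norm x) + ereal v * ereal (norm y)"
      by simp
  qed
  ultimately show ?thesis by (simp add: convex_lsc_funs_def lower_semicontinuous_def)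
qed

text \<open>The conjugate of the norm vanishes on the unit ball.\<close>

lemma exp_conj_integral_norm_pos: "0 < exp_conj_integral (\<lambda>x::real ^ 'n. ereal (norm x))"
proof -
  have "measure lborel (ball (0::real ^ 'n) 1) > 0" by (rule content_ball_pos) simp
  then have "0 < emeasure lborel (ball (0::real ^ 'n) 1)"
    by (auto simp: measure_def zero_less_iff_neq_zero)
  also have "\<dots> = (\<integral>\<^sup>+y. indicator (ball (0::real ^ 'n) 1) y \<partial>lborel)" by simp
  also have "\<dots> \<le> exp_conj_integral (\<lambda>x::real ^ 'n. ereal (norm x))"
    unfolding exp_conj_integral_def
  proof (intro nn_integral_mono)
    fix y :: "real ^ 'n"
    show "indicator (ball 0 1) y \<le> exp_ereal (- conjugate (\<lambda>x. ereal (norm x)) y)"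
    proof (cases "y \<in> ball 0 1")
      case True
      have "conjugate (\<lambda>x. ereal (norm x)) y \<le> 0"
        unfolding conjugate_def
      proof (rule SUP_least)
        fix x
        have "x \<bullet> y \<le> norm x * norm y" by (rule norm_cauchy_schwarz)
        also have "\<dots> \<le> norm x * 1" using True by (intro mult_left_mono) auto
        finally show "ereal (x \<bullet> y) - ereal (norm x) \<le> 0" by simp
      qed
      then have "exp_ereal 0 \<le> exp_ereal (- conjugate (\<lambda>x. ereal (norm x)) y)"
        by (intro exp_ereal_mono) (simp add: ereal_0_le_uminus_iff)
      then show ?thesis using True by (simp add: exp_ereal_def zero_ereal_def)
    qed simp
  qed
  finally show ?thesis .
qed

text \<open>The norm is an admissible test function for every measure in \<open>P1\<close>. Where \<open>\<integral>f d\<nu> = \<infinity>\<close>, this lemma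
  excludes the difference \<open>-\<infinity> - (-\<infinity>)\<close>, which is \<open>\<infinity>\<close> in the extended reals.\<close>

lemma K_Leb_neq_minus_infinity:
  fixes \<nu> :: "(real ^ 'n) measure"
  assumes \<nu>: "\<nu> \<in> P1"
  shows "K_Leb \<nu> \<noteq> -\<infinity>"
proof -
  let ?g = "\<lambda>x::real ^ 'n. ereal (norm x)"
  have sets[measurable_cong]: "sets \<nu> = sets borel" using \<nu> by (simp add: P1_def)
  have "?g \<in> ereal_L1 \<nu>"
    using \<nu> by (auto simp: ereal_L1_def P1_def integrable_iff_bounded)
  then have "ereal_integral \<nu> (\<lambda>x. - ?g x) - L_Leb ?g \<le> K_Leb \<nu>"
    unfolding K_Leb_def using norm_in_convex_lsc_funs by (intro SUP_upper2[of ?g] IntI order_refl \<open>?g \<in> ereal_L1 \<nu>\<close>)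
  moreover have "L_Leb ?g \<noteq> \<infinity>"
    using exp_conj_integral_norm_pos[where 'n='n] by (auto simp: L_Leb_def ln_ennreal_def)
  ultimately show ?thesis
    using ereal_integral_uminus_L1[OF \<open>?g \<in> ereal_L1 \<nu>\<close>] by (cases "L_Leb ?g") auto
qed

text \<open>If \<open>f\<close> is integrable, it is a test function for \<open>K_Leb \<nu>\<close>. If not, then its positive part has infinite integral:
  a point where the conjugate is finite provides an affine function below \<open>f\<close>, so the negative part is
  integrable. In that case the left-hand side is \<open>-\<infinity>\<close>.\<close>

lemma dual_value_le_L_Leb:
  assumes f: "f \<in> convex_lsc_funs" and pos: "exp_conj_integral f > 0" and \<nu>: "\<nu> \<in> P1"
  shows "ereal_integral \<nu> (\<lambda>x. - f x) - K_Leb \<nu> \<le> L_Leb f"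
proof (cases "f \<in> ereal_L1 \<nu>")
  case True
  have "ereal_integral \<nu> (\<lambda>x. - f x) - L_Leb f \<le> K_Leb \<nu>"
    unfolding K_Leb_def using f True by (intro SUP_upper2[of f] IntI order_refl)
  then show ?thesis
    unfolding ereal_integral_uminus_L1[OF True] by (cases "L_Leb f"; cases "K_Leb \<nu>") auto
next
  case False
  interpret prob_space \<nu> using \<nu> by (simp add: P1_def)
  have sets[measurable_cong]: "sets \<nu> = sets borel" and int: "integrable \<nu> norm" using \<nu> by (simp_all add: P1_def)
  have proper: "f x \<noteq> -\<infinity>" for x using f by (simp add: convex_lsc_funs_def)
  have [measurable]: "f \<in> borel_measurable borel"
    using f by (intro lower_semicontinuous_borel_measurable) (simp add: convex_lsc_funs_def)
  have "\<exists>y. conjugate f y \<noteq> \<infinity>"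
  proof (rule ccontr)
    assume "\<not> ?thesis"
    then have "exp_conj_integral f = 0" by (simp add: exp_conj_integral_def exp_ereal_def)
    then show False using pos by simp
  qed
  then obtain y where y: "conjugate f y \<noteq> \<infinity>" by blast
  obtain x0 where "f x0 \<noteq> \<infinity>" using f by (auto simp: convex_lsc_funs_def)
  then obtain c where c: "conjugate f y = ereal c"
    using y conjugate_upper[of x0 y f] proper[of x0] by (cases "conjugate f y"; cases "f x0") auto
  have "e2ennreal (- f x) \<le> ennreal (norm y * norm x + \<bar>c\<bar>)" for x
  proof (cases "f x")
    case (real s)
    have "x \<bullet> y - s \<le> c" using conjugate_upper[of x y f] c real by simp
    moreover have "\<bar>x \<bullet> y\<bar> \<le> norm x * norm y" by (rule Cauchy_Schwarz_ineq2)
    ultimately have "- s \<le> norm y * norm x + \<bar>c\<bar>" by (simp add: mult.commute abs_le_iff) linarith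
    then show ?thesis by (simp only: real uminus_ereal.simps e2ennreal_ereal ennreal_leI)
  qed (use proper e2ennreal_neg in auto)
  then have "(\<integral>\<^sup>+x. e2ennreal (- f x) \<partial>\<nu>) \<le> (\<integral>\<^sup>+x. ennreal (norm y * norm x + \<bar>c\<bar>) \<partial>\<nu>)"
    by (intro nn_integral_mono)
  also have "\<dots> = ennreal (\<integral>x. norm y * norm x + \<bar>c\<bar> \<partial>\<nu>)"
    using int by (intro nn_integral_eq_integral) auto
  finally have neg: "(\<integral>\<^sup>+x. e2ennreal (- f x) \<partial>\<nu>) < top" by (simp add: le_less_trans)
  have "(\<integral>\<^sup>+x. e2ennreal \<bar>f x\<bar> \<partial>\<nu>) = (\<integral>\<^sup>+x. e2ennreal (f x) + e2ennreal (- f x) \<partial>\<nu>)"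
  proof (intro nn_integral_cong)
    fix x show "e2ennreal \<bar>f x\<bar> = e2ennreal (f x) + e2ennreal (- f x)"
    proof (cases "f x")
      case (real s)
      then show ?thesis by (cases "0 \<le> s") (auto simp: ennreal_neg)
    qed (auto simp: e2ennreal_neg)
  qed
  also have "\<dots> = (\<integral>\<^sup>+x. e2ennreal (f x) \<partial>\<nu>) + (\<integral>\<^sup>+x. e2ennreal (- f x) \<partial>\<nu>)"
    by (rule nn_integral_add) auto
  moreover have "(\<integral>\<^sup>+x. e2ennreal \<bar>f x\<bar> \<partial>\<nu>) = top"
    using False by (simp add: ereal_L1_def less_top[symmetric])
  ultimately have "(\<integral>\<^sup>+x. e2ennreal (f x) \<partial>\<nu>) = top"
    using neg by (metis ennreal_add_eq_top less_irrefl)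
  then have "ereal_integral \<nu> (\<lambda>x. - f x) = -\<infinity>"
    using neg by (cases "\<integral>\<^sup>+x. e2ennreal (- f x) \<partial>\<nu>") (auto simp: ereal_integral_def)
  then show ?thesis using K_Leb_neq_minus_infinity[OF \<nu>] by (cases "K_Leb \<nu>") auto
qed

lemma sign_flip_eq_reflection:
  fixes \<epsilon> x :: "real ^ 'n"
  shows "sign_flip \<epsilon> x = (\<Sum>b\<in>Basis. ((\<epsilon> \<bullet> b) * (x \<bullet> b)) *\<^sub>R b)"
proof (rule euclidean_eqI)
  fix b :: "real ^ 'n" assume b: "b \<in> Basis"
  then obtain i where "b = axis i 1" by (auto simp: Basis_vec_def)
  then have "sign_flip \<epsilon> x \<bullet> b = (\<epsilon> \<bullet> b) * (x \<bullet> b)"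
    by (simp add: sign_flip_def cart_eq_inner_axis[symmetric])
  also have "\<dots> = (\<Sum>b\<in>Basis. ((\<epsilon> \<bullet> b) * (x \<bullet> b)) *\<^sub>R b) \<bullet> b"
    using b by (simp add: inner_sum_left inner_Basis if_distrib if_distribR sum.delta cong: if_cong)
  finally show "sign_flip \<epsilon> x \<bullet> b = (\<Sum>b\<in>Basis. ((\<epsilon> \<bullet> b) * (x \<bullet> b)) *\<^sub>R b) \<bullet> b" .
qed

lemma norm_sign_flip:
  assumes "\<epsilon> \<in> sign_vectors"
  shows "norm (sign_flip \<epsilon> x) = norm x"
proof -
  have "\<bar>\<epsilon> $ i\<bar> = 1" for i using assms by (auto simp: sign_vectors_def dest: spec[of _ i])
  then show ?thesis by (simp add: norm_vec_def sign_flip_def abs_mult)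
qed

text \<open>The measure is the moment measure of the truncated conjugate. The truncation does not change the integral of \<open>f\<close>, because
  almost all maximizers lie in the ball and in the domain of \<open>f\<close>; the term \<open>\<integral>f d\<nu>\<close> then cancels against the
  bound on \<open>K_Leb\<close>.\<close>

lemma exists_near_optimal_measure:
  fixes f :: "real ^ 'n \<Rightarrow> ereal"
  assumes f: "f \<in> convex_lsc_funs" and r: "0 < r" "cball 0 r \<subseteq> {x. f x \<noteq> \<infinity>}" "r \<le> k"
  shows "\<exists>\<nu>\<in>P1. compact (measure_support \<nu>) \<and> (unconditional_fun f \<longrightarrow> \<nu> \<in> Pu1) \<and> (symmetric_fun f \<longrightarrow> \<nu> \<in> Ps1)
    \<and> - ln_ennreal (\<integral>\<^sup>+y. ennreal (exp (- ball_conjugate f k y)) \<partial>lborel)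
        \<le> ereal_integral \<nu> (\<lambda>x. - f x) - K_Leb \<nu>"
proof -
  have lsc: "lower_semicontinuous f" and proper: "\<And>x. f x \<noteq> -\<infinity>" using f by (auto simp: convex_lsc_funs_def)
  obtain a b where cc: "coercive_conjugate (domain_in_ball f k) (\<lambda>x. real_of_ereal (f x)) (ball_conjugate f k) k a b"
    using coercive_conjugate_ball_conjugate[OF lsc proper r] by blast
  interpret coercive_conjugate "domain_in_ball f k" "\<lambda>x. real_of_ereal (f x)" "ball_conjugate f k" k a b
    by (rule cc)
  have [measurable]: "f \<in> borel_measurable borel" by (rule lower_semicontinuous_borel_measurable[OF lsc])
  have P1: "moment_measure \<in> P1" using prob_space_moment_measure integrable_moment_measure_norm by (simp add: P1_def)
  have ae: "AE y in gibbs. f (maximizer y) = ereal (F_maximizer y)"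
    unfolding AE_gibbs_iff using AE_F_maximizer
  proof eventually_elim
    case (elim y)
    then show ?case using proper[of "maximizer y"] by (cases "f (maximizer y)") (auto simp: domain_in_ball_def)
  qed
  have "(\<integral>\<^sup>+x. e2ennreal \<bar>f x\<bar> \<partial>moment_measure) = (\<integral>\<^sup>+y. e2ennreal \<bar>f (maximizer y)\<bar> \<partial>gibbs)"
    unfolding moment_measure_def by (rule nn_integral_distr) auto
  also have "\<dots> = (\<integral>\<^sup>+y. ennreal (norm (F_maximizer y)) \<partial>gibbs)"
    by (rule nn_integral_cong_AE) (use ae in eventually_elim, simp)
  also have "\<dots> < \<infinity>" using integrable_F_maximizer by (simp add: integrable_iff_bounded)
  finally have L1: "f \<in> ereal_L1 moment_measure" by (simp add: ereal_L1_def)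
  have "(\<integral>x. real_of_ereal (f x) \<partial>moment_measure) = (\<integral>y. real_of_ereal (f (maximizer y)) \<partial>gibbs)"
    unfolding moment_measure_def by (rule integral_distr) auto
  also have "\<dots> = (\<integral>y. F_maximizer y \<partial>gibbs)"
    by (rule integral_cong_AE) (use ae in \<open>auto elim: eventually_mono\<close>)
  finally have eq: "ereal_integral moment_measure (\<lambda>x. - f x) = ereal (- (\<integral>y. F_maximizer y \<partial>gibbs))"
    using ereal_integral_uminus_L1[OF L1] by simp
  have "- ereal (ln total_mass) \<le> ereal_integral moment_measure (\<lambda>x. - f x) - K_Leb moment_measure"
    using K_Leb_tangent_le[OF cc] unfolding eq by (cases "K_Leb moment_measure") auto
  moreover have "ln_ennreal (\<integral>\<^sup>+y. ennreal (exp (- ball_conjugate f k y)) \<partial>lborel) = ereal (ln total_mass)"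
    unfolding nn_integral_exp_phi using total_mass_pos by (simp add: ln_ennreal_def)
  ultimately have "- ln_ennreal (\<integral>\<^sup>+y. ennreal (exp (- ball_conjugate f k y)) \<partial>lborel)
        \<le> ereal_integral moment_measure (\<lambda>x. - f x) - K_Leb moment_measure" by simp
  moreover have flip: "distr moment_measure borel (sign_flip \<epsilon>) = moment_measure"
    if \<epsilon>: "\<epsilon> \<in> sign_vectors" and inv: "\<And>x. f (sign_flip \<epsilon> x) = f x" for \<epsilon>
  proof -
    have "distr moment_measure borel (\<lambda>x. \<Sum>b\<in>Basis. ((\<epsilon> \<bullet> b) * (x \<bullet> b)) *\<^sub>R b) = moment_measure"
    proof (rule distr_moment_measure_reflection)
      fix b :: "real ^ 'n" assume "b \<in> Basis"
      then obtain i where "b = axis i 1" by (auto simp: Basis_vec_def)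
      then show "\<bar>\<epsilon> \<bullet> b\<bar> = 1"
        using \<epsilon> by (auto simp: sign_vectors_def cart_eq_inner_axis[symmetric] dest: spec[of _ i])
    qed (use inv norm_sign_flip[OF \<epsilon>] in \<open>auto simp: sign_flip_eq_reflection[symmetric] domain_in_ball_def\<close>)
    then show ?thesis by (simp add: sign_flip_eq_reflection[abs_def])
  qed
  moreover have "distr moment_measure borel uminus = moment_measure" if "symmetric_fun f"
  proof -
    \<comment> \<open>The central symmetry is the reflection in all coordinates at once.\<close>
    have minus: "sign_flip (\<chi> i. - 1) = (uminus :: real ^ 'n \<Rightarrow> _)"
      by (auto simp: sign_flip_def fun_eq_iff vec_eq_iff)
    show ?thesis
      using flip[of "\<chi> i. - 1"] that by (simp add: minus symmetric_fun_def sign_vectors_def)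
  qed
  ultimately show ?thesis
    using P1 compact_support_moment_measure by (intro bexI[of _ moment_measure]) (auto simp: Pu1_def Ps1_def unconditional_fun_def)
qed

text \<open>One statement for all four suprema: the set \<open>A\<close> only has to contain the measures with compact support and
  with the symmetries of \<open>f\<close>.\<close>

lemma SUP_dual_value_eq_L_Leb:
  fixes f :: "real ^ 'n \<Rightarrow> ereal"
  assumes f: "f \<in> convex_lsc_funs" and pos: "exp_conj_integral f > 0"
    and A: "A \<subseteq> P1"
      "\<And>\<nu>. \<nu> \<in> P1 \<Longrightarrow> compact (measure_support \<nu>) \<Longrightarrow> (unconditional_fun f \<longrightarrow> \<nu> \<in> Pu1)
         \<Longrightarrow> (symmetric_fun f \<longrightarrow> \<nu> \<in> Ps1) \<Longrightarrow> \<nu> \<in> A"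
  shows "(SUP \<nu>\<in>A. ereal_integral \<nu> (\<lambda>x. - f x) - K_Leb \<nu>) = L_Leb f"
proof (rule antisym)
  show "(SUP \<nu>\<in>A. ereal_integral \<nu> (\<lambda>x. - f x) - K_Leb \<nu>) \<le> L_Leb f"
    using dual_value_le_L_Leb[OF f pos] A(1) by (intro SUP_least) auto
  let ?sup = "SUP \<nu>\<in>A. ereal_integral \<nu> (\<lambda>x. - f x) - K_Leb \<nu>"
  show "L_Leb f \<le> ?sup"
  proof (cases "exp_conj_integral f")
    case top
    then show ?thesis by (simp add: L_Leb_def ln_ennreal_def)
  next
    case (real i)
    then have i: "0 < i" using pos by (simp add: ennreal_eq_0_iff zero_less_iff_neq_zero)
    \<comment> \<open>A ball around \<open>0\<close> in the domain of \<open>f\<close> is the smallest ball to which \<open>f\<close> is truncated.\<close>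
    have "0 \<in> interior {x. f x \<noteq> \<infinity>}"
      using zero_in_interior_domain[OF f pos] real by simp
    then obtain r where r: "0 < r" "cball 0 r \<subseteq> {x. f x \<noteq> \<infinity>}" by (auto simp: mem_interior_cball)
    let ?Z = "\<lambda>m. \<integral>\<^sup>+y. ennreal (exp (- ball_conjugate f (r + real m) y)) \<partial>lborel"
    have le: "- ln_ennreal (?Z m) \<le> ?sup" for m
    proof -
      obtain \<nu> where "\<nu> \<in> A" "- ln_ennreal (?Z m) \<le> ereal_integral \<nu> (\<lambda>x. - f x) - K_Leb \<nu>"
        using exists_near_optimal_measure[OF f r, of "r + real m"] A(2) by auto
      then show ?thesis by (intro SUP_upper2)
    qed
    have lim: "?Z \<longlonglongrightarrow> ennreal i" using truncated_integral_tendsto[OF f r] real by simp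
    then have "(\<lambda>m. enn2real (?Z m)) \<longlonglongrightarrow> i" using i by (intro tendsto_enn2real) auto
    then have "(\<lambda>m. ln (enn2real (?Z m))) \<longlonglongrightarrow> ln i" using i by (intro tendsto_ln) auto
    then have "(\<lambda>m. - ereal (ln (enn2real (?Z m)))) \<longlonglongrightarrow> - ereal (ln i)" by (auto intro: tendsto_intros)
    moreover have "eventually (\<lambda>m. - ereal (ln (enn2real (?Z m))) \<le> ?sup) sequentially"
    proof -
      have "eventually (\<lambda>m. 0 < ?Z m) sequentially" "eventually (\<lambda>m. ?Z m < top) sequentially"
        using order_tendstoD[OF lim] i by auto
      then show ?thesis
      proof eventually_elim
        case (elim m)
        then show ?case using le[of m] by (auto simp: ln_ennreal_def split: if_splits)
      qed
    qed
    ultimately have "- ereal (ln i) \<le> ?sup"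
      by (intro tendsto_upperbound) auto
    then show ?thesis using real i by (simp add: L_Leb_def ln_ennreal_def)
  qed
qed

theorem theorem3:
  fixes f :: "real ^ 'n \<Rightarrow> ereal"
  assumes "f \<in> convex_lsc_funs"
    and "exp_conj_integral f > 0"
  shows "(SUP \<nu> \<in> P1. ereal_integral \<nu> (\<lambda>x. - f x) - K_Leb \<nu>) = L_Leb f
    \<and> (SUP \<nu> \<in> {\<nu> \<in> P1. compact (measure_support \<nu>)}.
          ereal_integral \<nu> (\<lambda>x. - f x) - K_Leb \<nu>) = L_Leb f
    \<and> (unconditional_fun f \<longrightarrow>
        (SUP \<nu> \<in> Pu1. ereal_integral \<nu> (\<lambda>x. - f x) - K_Leb \<nu>) = L_Leb f)
    \<and> (symmetric_fun f \<longrightarrow>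
        (SUP \<nu> \<in> Ps1. ereal_integral \<nu> (\<lambda>x. - f x) - K_Leb \<nu>) = L_Leb f)"
  by (intro conjI impI SUP_dual_value_eq_L_Leb assms) (auto simp: Pu1_def Ps1_def)

end
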